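(* Let $\mathcal{T}$ be a triangulated category with suspension functor $\Sigma$, and let $\mathcal{A}\subseteq\mathcal{T}$ be a proper abelian subcategory. Assume that $\mathcal{T}$ is Krull-Schmidt and that $\mathcal{T}(\mathcal{A},\Sigma^{-i}\mathcal{A})=0$ for $i=1,2$. For each $c\in\Sigma\mathcal{A}\ast\mathcal{A}$ there exist a unique (up to isomorphism) minimal right $\Sigma\mathcal{A}$-approximation $\Sigma a_1\to c$ (with $a_1\in\mathcal{A}$) and a unique (up to isomorphism) minimal left $\mathcal{A}$-approximation $c\to a_0$ (with $a_0\in\mathcal{A}$). Defining $F(c)=a_1$ and $G(c)=a_0$ induces two functors $F,G:\Sigma\mathcal{A}\ast\mathcal{A}\to\mathcal{A}$ with the following property. Let $$c\xrightarrow{f}c'\xrightarrow{g}c''\to\Sigma c$$ be a triangle in $\mathcal{T}$ with $c,c',c''\in\Sigma\mathcal{A}\ast\mathcal{A}$. Then there exists a morphism $\delta:F(c'')\to G(c)$ such that $$0\to F(c)\xrightarrow{F(f)}F(c')\xrightarrow{F(g)}F(c'')\xrightarrow{\delta}G(c)\xrightarrow{G(f)}G(c')\xrightarrow{G(g)}G(c'')\to 0$$ is an exact sequence in $\mathcal{A}$.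
   Context: All subcategories are full. "Triangle" means distinguished triangle. $\mathcal{T}(x,y)$ denotes $\mathrm{Hom}_{\mathcal{T}}(x,y)$, and $\mathcal{T}(\mathcal{X},\mathcal{Y})=0$ means $\mathcal{T}(x,y)=0$ for all $x\in\mathcal{X}$, $y\in\mathcal{Y}$. An additive subcategory is a subcategory closed under isomorphisms, direct sums and direct summands. An additive subcategory $\mathcal{A}\subseteq\mathcal{T}$ is a proper abelian subcategory if it is abelian in such a way that $a\xrightarrow{\alpha}a'\xrightarrow{\alpha'}a''$ is a short exact sequence in $\mathcal{A}$ if and only if there is a triangle $a\xrightarrow{\alpha}a'\xrightarrow{\alpha'}a''\to\Sigma a$ in $\mathcal{T}$. For subcategories $\mathcal{X},\mathcal{Y}\subseteq\mathcal{T}$, $\mathcal{X}\ast\mathcal{Y}$ is the subcategory of objects $z$ for which there is a triangle $x\to z\to y\to\Sigma x$ in $\mathcal{T}$ with $x\in\mathcal{X}$, $y\in\mathcal{Y}$. A right $\mathcal{X}$-approximation of $c$ is a morphism $\phi:x\to c$ with $x\in\mathcal{X}$ through which every morphism $x'\to c$ with $x'\in\mathcal{X}$ factors; it is minimal if every endomorphism $e$ of $x$ with $\phi e=\phi$ is an isomorphism. Left approximations and minimality are defined dually. Action on morphisms: write $\phi_c:\Sigma F(c)\to c$ and $\psi_c:c\to G(c)$ for the chosen minimal approximations. For $f:c\to c'$ in $\Sigma\mathcal{A}\ast\mathcal{A}$, $F(f)$ is the unique morphism with $\phi_{c'}\circ\Sigma F(f)=f\circ\phi_c$, and $G(f)$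 is the unique morphism with $G(f)\circ\psi_c=\psi_{c'}\circ f$. *)

theory Defs
  imports "HOL-Algebra.Ring"
begin

text \<open>Morphisms know their endpoints: different hom-sets are required to be disjoint, so that
  \<open>g \<cdot> f\<close> (first \<open>f\<close>, then \<open>g\<close>) needs no object annotations.  The operations \<open>Plus\<close>
  and \<open>Zero\<close> carry the abelian group structure of the hom-sets.\<close>

record ('o, 'm) precat =
  Ob    :: "'o set"
  Hom   :: "'o \<Rightarrow> 'o \<Rightarrow> 'm set"
  Ident :: "'o \<Rightarrow> 'm"
  Cmp   :: "'m \<Rightarrow> 'm \<Rightarrow> 'm"  (infixl "\<cdot>\<index>" 70)
  Plus  :: "'m \<Rightarrow> 'm \<Rightarrow> 'm"
  Zero  :: "'o \<Rightarrow> 'o \<Rightarrow> 'm"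

locale category =
  fixes C :: "('o, 'm, 'z) precat_scheme" (structure)
  assumes hom_ob: "f \<in> Hom C x y \<Longrightarrow> x \<in> Ob C \<and> y \<in> Ob C"
    and hom_disjoint: "f \<in> Hom C x y \<Longrightarrow> f \<in> Hom C x' y' \<Longrightarrow> x = x' \<and> y = y'"
    and ident_hom: "x \<in> Ob C \<Longrightarrow> Ident C x \<in> Hom C x x"
    and cmp_hom: "f \<in> Hom C x y \<Longrightarrow> g \<in> Hom C y z \<Longrightarrow> g \<cdot> f \<in> Hom C x z"
    and ident_left: "f \<in> Hom C x y \<Longrightarrow> Ident C y \<cdot> f = f"
    and ident_right: "f \<in> Hom C x y \<Longrightarrow> f \<cdot> Ident C x = f"
    and cmp_assoc: "f \<in> Hom C w x \<Longrightarrow> g \<in> Hom C x y \<Longrightarrow> h \<in> Hom C y z \<Longrightarrow>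
      h \<cdot> (g \<cdot> f) = (h \<cdot> g) \<cdot> f"

text \<open>\<open>hom_grp C x y\<close> is used for its additive structure; its multiplicative part is only
  meaningful for \<open>x = y\<close>, where \<open>hom_grp C x x\<close> is the endomorphism ring of \<open>x\<close>.\<close>

definition hom_grp :: "('o, 'm, 'z) precat_scheme \<Rightarrow> 'o \<Rightarrow> 'o \<Rightarrow> 'm ring" where
  "hom_grp C x y =
     \<lparr>carrier = Hom C x y, mult = Cmp C, one = Ident C x, zero = Zero C x y, add = Plus C\<rparr>"

locale preadditive_category = category +
  assumes hom_abelian_group: "x \<in> Ob C \<Longrightarrow> y \<in> Ob C \<Longrightarrow> abelian_group (hom_grp C x y)"
    and cmp_plus_right: "f \<in> Hom C x y \<Longrightarrow> f' \<in> Hom C x y \<Longrightarrow> g \<in> Hom C y z \<Longrightarrow>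
      g \<cdot> Plus C f f' = Plus C (g \<cdot> f) (g \<cdot> f')"
    and cmp_plus_left: "f \<in> Hom C x y \<Longrightarrow> g \<in> Hom C y z \<Longrightarrow> g' \<in> Hom C y z \<Longrightarrow>
      Plus C g g' \<cdot> f = Plus C (g \<cdot> f) (g' \<cdot> f)"

definition is_isomorphism :: "('o, 'm, 'z) precat_scheme \<Rightarrow> 'm \<Rightarrow> bool" where
  "is_isomorphism C f \<longleftrightarrow> (\<exists>x y g. f \<in> Hom C x y \<and> g \<in> Hom C y x \<and>
     g \<cdot>\<^bsub>C\<^esub> f = Ident C x \<and> f \<cdot>\<^bsub>C\<^esub> g = Ident C y)"

definition isomorphic :: "('o, 'm, 'z) precat_scheme \<Rightarrow> 'o \<Rightarrow> 'o \<Rightarrow> bool" where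
  "isomorphic C x y \<longleftrightarrow> (\<exists>f \<in> Hom C x y. is_isomorphism C f)"

definition is_zero_ob :: "('o, 'm, 'z) precat_scheme \<Rightarrow> 'o \<Rightarrow> bool" where
  "is_zero_ob C z \<longleftrightarrow> z \<in> Ob C \<and>
     (\<forall>x \<in> Ob C. (\<exists>!f. f \<in> Hom C z x) \<and> (\<exists>!f. f \<in> Hom C x z))"

text \<open>\<open>x\<close> is a direct sum (biproduct) of \<open>xs 0, \<dots>, xs (n - 1)\<close>; for \<open>n = 0\<close> this says
  that \<open>x\<close> is a zero object.\<close>

definition is_direct_sum :: "('o, 'm, 'z) precat_scheme \<Rightarrow> nat \<Rightarrow> (nat \<Rightarrow> 'o) \<Rightarrow> 'o \<Rightarrow> bool" where
  "is_direct_sum C n xs x \<longleftrightarrow> x \<in> Ob C \<and> (\<forall>i<n. xs i \<in> Ob C) \<and>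
     (\<exists>\<iota> \<pi>. (\<forall>i<n. \<iota> i \<in> Hom C (xs i) x \<and> \<pi> i \<in> Hom C x (xs i)) \<and>
        (\<forall>i<n. \<forall>j<n. \<pi> i \<cdot>\<^bsub>C\<^esub> \<iota> j = (if i = j then Ident C (xs i) else Zero C (xs j) (xs i))) \<and>
        finsum (hom_grp C x x) (\<lambda>i. \<iota> i \<cdot>\<^bsub>C\<^esub> \<pi> i) {..<n} = Ident C x)"

locale additive_category = preadditive_category +
  assumes direct_sum_exists: "(\<And>i. i < n \<Longrightarrow> xs i \<in> Ob C) \<Longrightarrow> \<exists>x. is_direct_sum C n xs x"

definition local_ring :: "('a, 'b) ring_scheme \<Rightarrow> bool" where
  "local_ring R \<longleftrightarrow> ring R \<and> \<one>\<^bsub>R\<^esub> \<noteq> \<zero>\<^bsub>R\<^esub> \<and>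
     (\<forall>a \<in> carrier R - Units R. \<forall>b \<in> carrier R - Units R. a \<oplus>\<^bsub>R\<^esub> b \<notin> Units R)"

definition krull_schmidt :: "('o, 'm, 'z) precat_scheme \<Rightarrow> bool" where
  "krull_schmidt C \<longleftrightarrow> additive_category C \<and>
     (\<forall>x \<in> Ob C. \<exists>n xs. is_direct_sum C n xs x \<and> (\<forall>i<n. local_ring (hom_grp C (xs i) (xs i))))"

definition is_functor ::
  "('o, 'm, 'z) precat_scheme \<Rightarrow> ('p, 'n, 'y) precat_scheme \<Rightarrow> ('o \<Rightarrow> 'p) \<Rightarrow> ('m \<Rightarrow> 'n) \<Rightarrow> bool" where
  "is_functor C D FO FM \<longleftrightarrow>
     (\<forall>x \<in> Ob C. FO x \<in> Ob D \<and> FM (Ident C x) = Ident D (FO x)) \<and>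
     (\<forall>x y. \<forall>f \<in> Hom C x y. FM f \<in> Hom D (FO x) (FO y)) \<and>
     (\<forall>x y z. \<forall>f \<in> Hom C x y. \<forall>g \<in> Hom C y z. FM (g \<cdot>\<^bsub>C\<^esub> f) = FM g \<cdot>\<^bsub>D\<^esub> FM f)"

definition is_equivalence ::
  "('o, 'm, 'z) precat_scheme \<Rightarrow> ('p, 'n, 'y) precat_scheme \<Rightarrow> ('o \<Rightarrow> 'p) \<Rightarrow> ('m \<Rightarrow> 'n) \<Rightarrow> bool" where
  "is_equivalence C D FO FM \<longleftrightarrow> is_functor C D FO FM \<and>
     (\<forall>x \<in> Ob C. \<forall>y \<in> Ob C. bij_betw FM (Hom C x y) (Hom D (FO x) (FO y))) \<and>
     (\<forall>y \<in> Ob D. \<exists>x \<in> Ob C. isomorphic D (FO x) y)"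

definition full_sub :: "('o, 'm, 'z) precat_scheme \<Rightarrow> 'o set \<Rightarrow> ('o, 'm) precat" where
  "full_sub C X =
     \<lparr>Ob = X, Hom = (\<lambda>x y. if x \<in> X \<and> y \<in> X then Hom C x y else {}),
      Ident = Ident C, Cmp = Cmp C, Plus = Plus C, Zero = Zero C\<rparr>"

definition is_kernel :: "('o, 'm, 'z) precat_scheme \<Rightarrow> 'm \<Rightarrow> 'm \<Rightarrow> bool" where
  "is_kernel C f k \<longleftrightarrow> (\<exists>w x y. f \<in> Hom C x y \<and> k \<in> Hom C w x \<and> f \<cdot>\<^bsub>C\<^esub> k = Zero C w y \<and>
     (\<forall>u. \<forall>v \<in> Hom C u x. f \<cdot>\<^bsub>C\<^esub> v = Zero C u y \<longrightarrow> (\<exists>!t. t \<in> Hom C u w \<and> k \<cdot>\<^bsub>C\<^esub> t = v)))"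

definition is_cokernel :: "('o, 'm, 'z) precat_scheme \<Rightarrow> 'm \<Rightarrow> 'm \<Rightarrow> bool" where
  "is_cokernel C f p \<longleftrightarrow> (\<exists>x y w. f \<in> Hom C x y \<and> p \<in> Hom C y w \<and> p \<cdot>\<^bsub>C\<^esub> f = Zero C x w \<and>
     (\<forall>u. \<forall>v \<in> Hom C y u. v \<cdot>\<^bsub>C\<^esub> f = Zero C x u \<longrightarrow> (\<exists>!t. t \<in> Hom C w u \<and> t \<cdot>\<^bsub>C\<^esub> p = v)))"

definition is_mono :: "('o, 'm, 'z) precat_scheme \<Rightarrow> 'm \<Rightarrow> bool" where
  "is_mono C f \<longleftrightarrow> (\<exists>x y. f \<in> Hom C x y \<and>
     (\<forall>w. \<forall>g \<in> Hom C w x. \<forall>h \<in> Hom C w x. f \<cdot>\<^bsub>C\<^esub> g = f \<cdot>\<^bsub>C\<^esub> h \<longrightarrow> g = h))"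

definition is_epi :: "('o, 'm, 'z) precat_scheme \<Rightarrow> 'm \<Rightarrow> bool" where
  "is_epi C f \<longleftrightarrow> (\<exists>x y. f \<in> Hom C x y \<and>
     (\<forall>w. \<forall>g \<in> Hom C y w. \<forall>h \<in> Hom C y w. g \<cdot>\<^bsub>C\<^esub> f = h \<cdot>\<^bsub>C\<^esub> f \<longrightarrow> g = h))"

locale abelian_category = additive_category +
  assumes kernel_exists: "f \<in> Hom C x y \<Longrightarrow> \<exists>k. is_kernel C f k"
    and cokernel_exists: "f \<in> Hom C x y \<Longrightarrow> \<exists>p. is_cokernel C f p"
    and mono_is_kernel: "is_mono C k \<Longrightarrow> \<exists>f. is_kernel C f k"
    and epi_is_cokernel: "is_epi C p \<Longrightarrow> \<exists>f. is_cokernel C f p"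

definition is_image :: "('o, 'm, 'z) precat_scheme \<Rightarrow> 'm \<Rightarrow> 'm \<Rightarrow> bool" where
  "is_image C f i \<longleftrightarrow> (\<exists>p. is_cokernel C f p \<and> is_kernel C p i)"

text \<open>Exactness of \<open>x \<rightarrow> y \<rightarrow> z\<close> at \<open>y\<close>: the image of \<open>f\<close> and the kernel of \<open>g\<close> are the
  same subobject of \<open>y\<close>.\<close>

definition exact_at :: "('o, 'm, 'z) precat_scheme \<Rightarrow> 'm \<Rightarrow> 'm \<Rightarrow> bool" where
  "exact_at C f g \<longleftrightarrow> (\<exists>x y z. f \<in> Hom C x y \<and> g \<in> Hom C y z) \<and>
     (\<exists>k. is_image C f k \<and> is_kernel C g k)"

text \<open>Sequences are listed in diagram order, so \<open>fs ! i\<close> is followed by \<open>fs ! Suc i\<close>.\<close>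

definition exact_sequence :: "('o, 'm, 'z) precat_scheme \<Rightarrow> 'm list \<Rightarrow> bool" where
  "exact_sequence C fs \<longleftrightarrow> (\<forall>i. Suc i < length fs \<longrightarrow> exact_at C (fs ! i) (fs ! Suc i))"

definition short_exact :: "('o, 'm, 'z) precat_scheme \<Rightarrow> 'm \<Rightarrow> 'm \<Rightarrow> bool" where
  "short_exact C f g \<longleftrightarrow> (\<exists>x y w z. f \<in> Hom C x y \<and> g \<in> Hom C y w \<and> is_zero_ob C z \<and>
     exact_sequence C [Zero C z x, f, g, Zero C w z])"

text \<open>A triangle \<open>x \<rightarrow> y \<rightarrow> z \<rightarrow> \<Sigma>x\<close> is given by its three morphisms.\<close>

record ('o, 'm) tricat = "('o, 'm) precat" +
  SuspO :: "'o \<Rightarrow> 'o"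
  SuspM :: "'m \<Rightarrow> 'm"
  Tri   :: "('m \<times> 'm \<times> 'm) set"

definition is_candidate :: "('o, 'm, 'z) tricat_scheme \<Rightarrow> 'm \<Rightarrow> 'm \<Rightarrow> 'm \<Rightarrow> bool" where
  "is_candidate T f g h \<longleftrightarrow>
     (\<exists>x y z. f \<in> Hom T x y \<and> g \<in> Hom T y z \<and> h \<in> Hom T z (SuspO T x))"

definition is_tri_morphism ::
  "('o, 'm, 'z) tricat_scheme \<Rightarrow> 'm \<times> 'm \<times> 'm \<Rightarrow> 'm \<times> 'm \<times> 'm \<Rightarrow> 'm \<Rightarrow> 'm \<Rightarrow> 'm \<Rightarrow> bool" where
  "is_tri_morphism T = (\<lambda>(f, g, h) (f', g', h') u v w. \<exists>x y z x' y' z'.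
     f \<in> Hom T x y \<and> g \<in> Hom T y z \<and> h \<in> Hom T z (SuspO T x) \<and>
     f' \<in> Hom T x' y' \<and> g' \<in> Hom T y' z' \<and> h' \<in> Hom T z' (SuspO T x') \<and>
     u \<in> Hom T x x' \<and> v \<in> Hom T y y' \<and> w \<in> Hom T z z' \<and>
     v \<cdot>\<^bsub>T\<^esub> f = f' \<cdot>\<^bsub>T\<^esub> u \<and> w \<cdot>\<^bsub>T\<^esub> g = g' \<cdot>\<^bsub>T\<^esub> v \<and> SuspM T u \<cdot>\<^bsub>T\<^esub> h = h' \<cdot>\<^bsub>T\<^esub> w)"

text \<open>The suspension is only required to be an additive autoequivalence; this includes the
  convention that it is an automorphism.\<close>

locale triangulated_category = additive_category T
  for T :: "('o, 'm, 'z) tricat_scheme" (structure) +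
  assumes susp_equivalence: "is_equivalence T T (SuspO T) (SuspM T)"
    and susp_plus: "f \<in> Hom T x y \<Longrightarrow> g \<in> Hom T x y \<Longrightarrow>
      SuspM T (Plus T f g) = Plus T (SuspM T f) (SuspM T g)"
    and tri_candidate: "(f, g, h) \<in> Tri T \<Longrightarrow> is_candidate T f g h"
    and tri_iso: "(f, g, h) \<in> Tri T \<Longrightarrow> is_tri_morphism T (f, g, h) (f', g', h') u v w \<Longrightarrow>
      is_isomorphism T u \<Longrightarrow> is_isomorphism T v \<Longrightarrow> is_isomorphism T w \<Longrightarrow> (f', g', h') \<in> Tri T"
    and tri_ident: "x \<in> Ob T \<Longrightarrow> is_zero_ob T z \<Longrightarrow>
      (Ident T x, Zero T x z, Zero T z (SuspO T x)) \<in> Tri T"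
    and tri_exists: "f \<in> Hom T x y \<Longrightarrow> \<exists>g h. (f, g, h) \<in> Tri T"
    and tri_rotate: "f \<in> Hom T x y \<Longrightarrow> g \<in> Hom T y z \<Longrightarrow> h \<in> Hom T z (SuspO T x) \<Longrightarrow>
      (f, g, h) \<in> Tri T \<longleftrightarrow>
      (g, h, \<ominus>\<^bsub>hom_grp T (SuspO T x) (SuspO T y)\<^esub> SuspM T f) \<in> Tri T"
    and tri_fill: "(f, g, h) \<in> Tri T \<Longrightarrow> (f', g', h') \<in> Tri T \<Longrightarrow>
      f \<in> Hom T x y \<Longrightarrow> f' \<in> Hom T x' y' \<Longrightarrow> u \<in> Hom T x x' \<Longrightarrow> v \<in> Hom T y y' \<Longrightarrow>
      v \<cdot> f = f' \<cdot> u \<Longrightarrow> \<exists>w. is_tri_morphism T (f, g, h) (f', g', h') u v w"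
    and octahedral: "f \<in> Hom T x y \<Longrightarrow> g \<in> Hom T y z \<Longrightarrow>
      (f, i, i') \<in> Tri T \<Longrightarrow> (g, j, j') \<in> Tri T \<Longrightarrow> (g \<cdot> f, k, k') \<in> Tri T \<Longrightarrow>
      i \<in> Hom T y p \<Longrightarrow> k \<in> Hom T z q \<Longrightarrow> j \<in> Hom T z r \<Longrightarrow>
      \<exists>u \<in> Hom T p q. \<exists>v \<in> Hom T q r. (u, v, SuspM T i \<cdot> j') \<in> Tri T \<and>
        u \<cdot> i = k \<cdot> g \<and> k' \<cdot> u = i' \<and> v \<cdot> k = j \<and> j' \<cdot> v = SuspM T f \<cdot> k'"

definition hom_vanish :: "('o, 'm, 'z) precat_scheme \<Rightarrow> 'o set \<Rightarrow> 'o set \<Rightarrow> bool" where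
  "hom_vanish C X Y \<longleftrightarrow> (\<forall>x \<in> X. \<forall>y \<in> Y. Hom C x y = {Zero C x y})"

text \<open>The subcategory \<open>\<Sigma>\<^sup>-\<^sup>i X\<close>, up to isomorphism.  As the suspension need not have a strict
  inverse, \<open>\<Sigma>\<^sup>-\<^sup>i x\<close> stands for any object whose \<open>i\<close>-fold suspension is isomorphic to \<open>x\<close>.\<close>

definition desusp :: "('o, 'm, 'z) tricat_scheme \<Rightarrow> nat \<Rightarrow> 'o set \<Rightarrow> 'o set" where
  "desusp T i X = {z \<in> Ob T. \<exists>x \<in> X. isomorphic T ((SuspO T ^^ i) z) x}"

definition ext_product :: "('o, 'm, 'z) tricat_scheme \<Rightarrow> 'o set \<Rightarrow> 'o set \<Rightarrow> 'o set" where
  "ext_product T X Y = {z. \<exists>x \<in> X. \<exists>y \<in> Y. \<exists>f \<in> Hom T x z. \<exists>g \<in> Hom T z y. \<exists>h. (f, g, h) \<in> Tri T}"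

definition additive_subcategory :: "('o, 'm, 'z) precat_scheme \<Rightarrow> 'o set \<Rightarrow> bool" where
  "additive_subcategory C A \<longleftrightarrow> A \<subseteq> Ob C \<and>
     (\<forall>a \<in> A. \<forall>x. isomorphic C a x \<longrightarrow> x \<in> A) \<and>
     (\<forall>n xs x. is_direct_sum C n xs x \<and> (\<forall>i<n. xs i \<in> A) \<longrightarrow> x \<in> A) \<and>
     (\<forall>n xs x. is_direct_sum C n xs x \<and> x \<in> A \<longrightarrow> (\<forall>i<n. xs i \<in> A))"

definition proper_abelian_subcategory :: "('o, 'm, 'z) tricat_scheme \<Rightarrow> 'o set \<Rightarrow> bool" where
  "proper_abelian_subcategory T A \<longleftrightarrow> additive_subcategory T A \<and>
     abelian_category (full_sub T A) \<and>
     (\<forall>a \<in> A. \<forall>a' \<in> A. \<forall>a'' \<in> A. \<forall>\<alpha> \<in> Hom T a a'. \<forall>\<alpha>' \<in> Hom T a' a''.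
        short_exact (full_sub T A) \<alpha> \<alpha>' \<longleftrightarrow> (\<exists>h. (\<alpha>, \<alpha>', h) \<in> Tri T))"

definition right_approx ::
  "('o, 'm, 'z) precat_scheme \<Rightarrow> 'o set \<Rightarrow> 'o \<Rightarrow> 'o \<Rightarrow> 'm \<Rightarrow> bool" where
  "right_approx C X x c \<phi> \<longleftrightarrow> x \<in> X \<and> \<phi> \<in> Hom C x c \<and>
     (\<forall>x' \<in> X. \<forall>\<phi>' \<in> Hom C x' c. \<exists>\<theta> \<in> Hom C x' x. \<phi> \<cdot>\<^bsub>C\<^esub> \<theta> = \<phi>')"

definition min_right_approx ::
  "('o, 'm, 'z) precat_scheme \<Rightarrow> 'o set \<Rightarrow> 'o \<Rightarrow> 'o \<Rightarrow> 'm \<Rightarrow> bool" where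
  "min_right_approx C X x c \<phi> \<longleftrightarrow> right_approx C X x c \<phi> \<and>
     (\<forall>e \<in> Hom C x x. \<phi> \<cdot>\<^bsub>C\<^esub> e = \<phi> \<longrightarrow> is_isomorphism C e)"

definition left_approx ::
  "('o, 'm, 'z) precat_scheme \<Rightarrow> 'o set \<Rightarrow> 'o \<Rightarrow> 'o \<Rightarrow> 'm \<Rightarrow> bool" where
  "left_approx C X c x \<psi> \<longleftrightarrow> x \<in> X \<and> \<psi> \<in> Hom C c x \<and>
     (\<forall>x' \<in> X. \<forall>\<psi>' \<in> Hom C c x'. \<exists>\<theta> \<in> Hom C x x'. \<theta> \<cdot>\<^bsub>C\<^esub> \<psi> = \<psi>')"

definition min_left_approx ::
  "('o, 'm, 'z) precat_scheme \<Rightarrow> 'o set \<Rightarrow> 'o \<Rightarrow> 'o \<Rightarrow> 'm \<Rightarrow> bool" where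
  "min_left_approx C X c x \<psi> \<longleftrightarrow> left_approx C X c x \<psi> \<and>
     (\<forall>e \<in> Hom C x x. e \<cdot>\<^bsub>C\<^esub> \<psi> = \<psi> \<longrightarrow> is_isomorphism C e)"

text \<open>\<open>F_rel T F \<phi> c c' f h\<close> is the equation \<open>\<phi>\<^sub>c' \<cdot> \<Sigma>h = f \<cdot> \<phi>\<^sub>c\<close> characterizing
  \<open>h = F f\<close>, where \<open>\<phi>\<^sub>c : \<Sigma>(F c) \<rightarrow> c\<close> are the chosen approximations; dually for \<open>G\<close> with
  \<open>\<psi>\<^sub>c : c \<rightarrow> G c\<close>.  The endpoints \<open>c\<close>, \<open>c'\<close> are determined by \<open>f\<close>.\<close>

definition F_rel :: "('o, 'm, 'z) tricat_scheme \<Rightarrow> ('o \<Rightarrow> 'o) \<Rightarrow> ('o \<Rightarrow> 'm) \<Rightarrow>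
    'o \<Rightarrow> 'o \<Rightarrow> 'm \<Rightarrow> 'm \<Rightarrow> bool" where
  "F_rel T F \<phi> c c' f h \<longleftrightarrow> f \<in> Hom T c c' \<and> h \<in> Hom T (F c) (F c') \<and>
     \<phi> c' \<cdot>\<^bsub>T\<^esub> SuspM T h = f \<cdot>\<^bsub>T\<^esub> \<phi> c"

definition G_rel :: "('o, 'm, 'z) tricat_scheme \<Rightarrow> ('o \<Rightarrow> 'o) \<Rightarrow> ('o \<Rightarrow> 'm) \<Rightarrow>
    'o \<Rightarrow> 'o \<Rightarrow> 'm \<Rightarrow> 'm \<Rightarrow> bool" where
  "G_rel T G \<psi> c c' f h \<longleftrightarrow> f \<in> Hom T c c' \<and> h \<in> Hom T (G c) (G c') \<and>
     h \<cdot>\<^bsub>T\<^esub> \<psi> c = \<psi> c' \<cdot>\<^bsub>T\<^esub> f"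

definition F_mor :: "('o, 'm, 'z) tricat_scheme \<Rightarrow> ('o \<Rightarrow> 'o) \<Rightarrow> ('o \<Rightarrow> 'm) \<Rightarrow> 'm \<Rightarrow> 'm" where
  "F_mor T F \<phi> f = (THE h. \<exists>c c'. F_rel T F \<phi> c c' f h)"

definition G_mor :: "('o, 'm, 'z) tricat_scheme \<Rightarrow> ('o \<Rightarrow> 'o) \<Rightarrow> ('o \<Rightarrow> 'm) \<Rightarrow> 'm \<Rightarrow> 'm" where
  "G_mor T G \<psi> f = (THE h. \<exists>c c'. G_rel T G \<psi> c c' f h)"

end

(* The vanishing conditions say T(\<Sigma>A, A) = T(\<Sigma>\<Sigma>A, A) = T(\<Sigma>\<Sigma>A, \<Sigma>A) = 0.  Hence in a triangle
   \<Sigma>a\<^sub>1 \<rightarrow> c \<rightarrow> a\<^sub>0 \<rightarrow> \<Sigma>\<Sigma>a\<^sub>1 the outer maps are universal: every \<Sigma>a \<rightarrow> c factors uniquely through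
   \<Sigma>a\<^sub>1, every c \<rightarrow> a factors uniquely through a\<^sub>0.  They are therefore minimal approximations, and
   the long exact Hom sequences turn a triangle c \<rightarrow> c' \<rightarrow> c'' \<rightarrow> \<Sigma>c into a kernel F f of F g and a
   cokernel G g of G f.  The connecting map is given by \<Sigma>\<delta> = (\<Sigma>c \<rightarrow> \<Sigma>(G c)) h (\<Sigma>(F c'') \<rightarrow> c'').
   Exactness on its two sides is a diagram chase comparing the given triangle with the triangles of
   the short exact sequences F c \<rightarrow> F c' \<rightarrow> coker (F f) and ker (G g) \<rightarrow> G c' \<rightarrow> G c''; the
   fill-in morphisms are forced by the vanishing of T(\<Sigma>\<Sigma>A, \<Sigma>A * A) and T(\<Sigma>(\<Sigma>A * A), A). *)

theory Submission
  imports Defs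
begin

text \<open>Three obstacles shape the proof. The suspension is only an equivalence, so nothing can
  be desuspended strictly: Hom sequences are continued to the right, maps are compared after one or
  two suspensions, and full faithfulness brings the result back. Fill-ins of triangles are not
  unique, so an abstract fill-in says nothing about \<open>\<delta>\<close>. On each side of
  \<open>\<delta>\<close> it is identified with an explicit map, because the difference of the two
  factors through a vanishing Hom group. Finally, the obvious lift fails: if \<open>\<delta>\<close>
  kills a map \<open>x\<close> into \<open>F c''\<close>, the obstruction to lifting it along
  \<open>g\<close> need not vanish; it only comes from \<Sigma>\<Sigma>(F c). The remedy is to
  change \<open>x\<close> by a map through coker (F f), which a cokernel of F g does not see.
  Dually, a map through ker (G g) is split off, and it dies on whatever G f kills. Exactness is
  therefore tested against cokernels of F g and of \<open>\<delta>\<close> instead of by direct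
  lifting.\<close>

section \<open>Morphisms with source and target\<close>

context category
begin

text \<open>Side conditions \<open>arr f\<close> and \<open>tgt f = src g\<close> contain no extra variables, unlike
  \<open>f \<in> Hom C x y\<close>, so conditional rewriting can discharge them.\<close>

definition arr :: "'m \<Rightarrow> bool" where
  "arr f \<longleftrightarrow> (\<exists>x y. f \<in> Hom C x y)"

definition src :: "'m \<Rightarrow> 'o" where
  "src f = (THE x. \<exists>y. f \<in> Hom C x y)"

definition tgt :: "'m \<Rightarrow> 'o" where
  "tgt f = (THE y. \<exists>x. f \<in> Hom C x y)"

lemma hom_arr: "f \<in> Hom C x y \<Longrightarrow> arr f \<and> src f = x \<and> tgt f = y"
  unfolding arr_def src_def tgt_def using hom_disjoint by blast

lemma hom_iff: "f \<in> Hom C x y \<longleftrightarrow> arr f \<and> src f = x \<and> tgt f = y"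
  using hom_arr by (metis arr_def)

lemma arr_hom: "arr f \<Longrightarrow> f \<in> Hom C (src f) (tgt f)"
  by (simp add: hom_iff)

lemma src_ob [simp]: "arr f \<Longrightarrow> src f \<in> Ob C"
  and tgt_ob [simp]: "arr f \<Longrightarrow> tgt f \<in> Ob C"
  using hom_ob arr_hom by blast+

lemma arr_Ident [simp]:
  "x \<in> Ob C \<Longrightarrow> arr (Ident C x)" "x \<in> Ob C \<Longrightarrow> src (Ident C x) = x" "x \<in> Ob C \<Longrightarrow> tgt (Ident C x) = x"
  using ident_hom[of x] by (simp_all add: hom_iff)

lemma arr_cmp [simp]:
  assumes "arr f" "arr g" "tgt f = src g"
  shows "arr (g \<cdot> f)" "src (g \<cdot> f) = src f" "tgt (g \<cdot> f) = tgt g"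
  using cmp_hom[of f "src f" "tgt f" g "tgt g"] assms by (simp_all add: hom_iff)

lemma ident_simps [simp]:
  "arr f \<Longrightarrow> tgt f = y \<Longrightarrow> Ident C y \<cdot> f = f"
  "arr f \<Longrightarrow> src f = x \<Longrightarrow> f \<cdot> Ident C x = f"
  using ident_left ident_right arr_hom by blast+

lemma assoc:
  assumes "arr f" "arr g" "arr h" "tgt f = src g" "tgt g = src h"
  shows "(h \<cdot> g) \<cdot> f = h \<cdot> (g \<cdot> f)"
  using cmp_assoc[of f "src f" "src g" g "src h" h "tgt h"] assms by (simp add: hom_iff)

text \<open>Normalising with \<open>assoc\<close> brackets composites to the right and thereby hides
  \<open>g \<cdot> f\<close> inside them. This rule rewrites such a hidden pair by a known
  equation.\<close>

lemma reassoc: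
  assumes "g \<cdot> f = k" "arr x" "arr f" "arr g" "tgt x = src f" "tgt f = src g"
  shows "g \<cdot> (f \<cdot> x) = k \<cdot> x"
  using assms assoc[of x f g] by simp

section \<open>Isomorphisms and uniqueness of minimal approximations\<close>

lemma is_isomorphism_iff:
  "is_isomorphism C f \<longleftrightarrow> arr f \<and> (\<exists>g. arr g \<and> src g = tgt f \<and> tgt g = src f \<and>
     g \<cdot> f = Ident C (src f) \<and> f \<cdot> g = Ident C (tgt f))"
  unfolding is_isomorphism_def by (auto simp: hom_iff)

lemma is_isomorphism_Ident: "x \<in> Ob C \<Longrightarrow> is_isomorphism C (Ident C x)"
  unfolding is_isomorphism_iff by (auto intro!: exI[of _ "Ident C x"])

text \<open>The hypotheses give \<open>f\<close> the left inverse \<open>l \<cdot> g\<close> and the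
  right inverse \<open>g \<cdot> r\<close>; inverses on the two sides always agree.\<close>

lemma is_isomorphismI_compositions:
  assumes f: "arr f" and g: "arr g" "src g = tgt f" "tgt g = src f"
    and gf: "is_isomorphism C (g \<cdot> f)" and fg: "is_isomorphism C (f \<cdot> g)"
  shows "is_isomorphism C f"
proof -
  obtain l where l: "arr l" "src l = src f" "tgt l = src f" "l \<cdot> (g \<cdot> f) = Ident C (src f)"
    using gf f g unfolding is_isomorphism_iff by auto
  obtain r where r: "arr r" "src r = tgt f" "tgt r = tgt f" "(f \<cdot> g) \<cdot> r = Ident C (tgt f)"
    using fg f g unfolding is_isomorphism_iff by auto
  have lf: "(l \<cdot> g) \<cdot> f = Ident C (src f)"
    using l f g by (simp add: assoc)
  have fr: "f \<cdot> (g \<cdot> r) = Ident C (tgt f)"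
    using r f g by (simp add: assoc)
  have "l \<cdot> g = (l \<cdot> g) \<cdot> (f \<cdot> (g \<cdot> r))"
    using fr l r f g by simp
  also have "\<dots> = Ident C (src f) \<cdot> (g \<cdot> r)"
    by (rule reassoc[OF lf]) (use l r f g in simp_all)
  also have "\<dots> = g \<cdot> r"
    using lf l r f g by simp
  finally have "f \<cdot> (l \<cdot> g) = Ident C (tgt f)"
    using fr by simp
  then show ?thesis
    unfolding is_isomorphism_iff using lf f g l by (auto intro!: exI[of _ "l \<cdot> g"])
qed

text \<open>Each approximation factors through the other. Both round trips fix an approximation, so
  minimality makes them isomorphisms, and then each single factorisation is one.\<close>

lemma min_right_approx_unique:
  assumes "min_right_approx C X x c \<phi>" "min_right_approx C X x' c \<phi>'"
  shows "\<exists>\<theta> \<in> Hom C x x'. is_isomorphism C \<theta> \<and> \<phi>' \<cdot> \<theta> = \<phi>"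
proof -
  have p: "arr \<phi>" "src \<phi> = x" "tgt \<phi> = c" "arr \<phi>'" "src \<phi>' = x'" "tgt \<phi>' = c"
    using assms by (auto simp: min_right_approx_def right_approx_def hom_iff)
  obtain s where s: "arr s" "src s = x" "tgt s = x'" "\<phi>' \<cdot> s = \<phi>"
    using assms unfolding min_right_approx_def right_approx_def
    by (metis hom_iff)
  obtain t where t: "arr t" "src t = x'" "tgt t = x" "\<phi> \<cdot> t = \<phi>'"
    using assms unfolding min_right_approx_def right_approx_def
    by (metis hom_iff)
  have "\<phi> \<cdot> (t \<cdot> s) = \<phi>" "\<phi>' \<cdot> (s \<cdot> t) = \<phi>'"
    using p s t by (simp_all add: assoc[symmetric])
  moreover have "t \<cdot> s \<in> Hom C x x" "s \<cdot> t \<in> Hom C x' x'"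
    using s t by (simp_all add: hom_iff)
  ultimately have "is_isomorphism C (t \<cdot> s)" "is_isomorphism C (s \<cdot> t)"
    using assms by (auto simp: min_right_approx_def)
  then show ?thesis
    using is_isomorphismI_compositions[of s t] s t by (auto simp: hom_iff)
qed

lemma min_left_approx_unique:
  assumes "min_left_approx C X c x \<psi>" "min_left_approx C X c x' \<psi>'"
  shows "\<exists>\<theta> \<in> Hom C x x'. is_isomorphism C \<theta> \<and> \<theta> \<cdot> \<psi> = \<psi>'"
proof -
  have p: "arr \<psi>" "tgt \<psi> = x" "src \<psi> = c" "arr \<psi>'" "tgt \<psi>' = x'" "src \<psi>' = c"
    using assms by (auto simp: min_left_approx_def left_approx_def hom_iff)
  obtain s where s: "arr s" "src s = x" "tgt s = x'" "s \<cdot> \<psi> = \<psi>'"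
    using assms unfolding min_left_approx_def left_approx_def
    by (metis hom_iff)
  obtain t where t: "arr t" "src t = x'" "tgt t = x" "t \<cdot> \<psi>' = \<psi>"
    using assms unfolding min_left_approx_def left_approx_def
    by (metis hom_iff)
  have "(t \<cdot> s) \<cdot> \<psi> = \<psi>" "(s \<cdot> t) \<cdot> \<psi>' = \<psi>'"
    using p s t by (simp_all add: assoc)
  moreover have "t \<cdot> s \<in> Hom C x x" "s \<cdot> t \<in> Hom C x' x'"
    using s t by (simp_all add: hom_iff)
  ultimately have "is_isomorphism C (t \<cdot> s)" "is_isomorphism C (s \<cdot> t)"
    using assms by (auto simp: min_left_approx_def)
  then show ?thesis
    using is_isomorphismI_compositions[of s t] s t by (auto simp: hom_iff)
qed

end

section \<open>Kernels, cokernels and exactness\<close>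

context preadditive_category
begin

text \<open>The Hom group is read off the endpoints of \<open>f\<close>, so negation carries no
  object arguments and rewriting can act on it.\<close>

definition neg :: "'b \<Rightarrow> 'b" where
  "neg f = \<ominus>\<^bsub>hom_grp C (src f) (tgt f)\<^esub> f"

section \<open>Arithmetic in the Hom groups\<close>

lemma hom_grp_simps [simp]:
  "carrier (hom_grp C x y) = Hom C x y" "\<zero>\<^bsub>hom_grp C x y\<^esub> = Zero C x y"
  "add (hom_grp C x y) = Plus C"
  by (simp_all add: hom_grp_def)

lemma arr_Zero [simp]:
  assumes "x \<in> Ob C" "y \<in> Ob C"
  shows "arr (Zero C x y)" "src (Zero C x y) = x" "tgt (Zero C x y) = y"
proof -
  interpret abelian_group "hom_grp C x y" using hom_abelian_group assms .
  show "arr (Zero C x y)" "src (Zero C x y) = x" "tgt (Zero C x y) = y"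
    using zero_closed by (simp_all add: hom_iff)
qed

lemma
  assumes "arr f" "arr g" "src f = src g" "tgt f = tgt g"
  shows arr_Plus [simp]: "arr (Plus C f g)" "src (Plus C f g) = src g" "tgt (Plus C f g) = tgt g"
    and plus_cancel: "Plus C f g = f \<longleftrightarrow> g = Zero C (src g) (tgt g)"
    and plus_zero: "g = Zero C (src g) (tgt g) \<Longrightarrow> Plus C f g = f"
proof -
  interpret abelian_group "hom_grp C (src g) (tgt g)"
    using hom_abelian_group assms by simp
  have h: "f \<in> Hom C (src g) (tgt g)" "g \<in> Hom C (src g) (tgt g)"
    using assms by (simp_all add: hom_iff)
  show "arr (Plus C f g)" "src (Plus C f g) = src g" "tgt (Plus C f g) = tgt g"
    using a_closed[of f g] h by (simp_all add: hom_iff)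
  show 1: "Plus C f g = f \<longleftrightarrow> g = Zero C (src g) (tgt g)"
    using add.l_cancel_one[of f g] h by simp
  then show "g = Zero C (src g) (tgt g) \<Longrightarrow> Plus C f g = f" by simp
qed

lemma plus_cancelD:
  "Plus C f g = f \<Longrightarrow> arr f \<Longrightarrow> arr g \<Longrightarrow> src f = x \<Longrightarrow> src g = x \<Longrightarrow> tgt f = y \<Longrightarrow> tgt g = y \<Longrightarrow>
    g = Zero C x y"
  using plus_cancel by metis

lemma
  assumes "arr f"
  shows arr_neg [simp]: "arr (neg f)" "src (neg f) = src f" "tgt (neg f) = tgt f"
    and plus_neg: "Plus C f (neg f) = Zero C (src f) (tgt f)"
    and neg_neg [simp]: "neg (neg f) = f"
proof -
  interpret abelian_group "hom_grp C (src f) (tgt f)"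
    using hom_abelian_group assms by simp
  have h: "f \<in> Hom C (src f) (tgt f)"
    using assms by (simp add: hom_iff)
  show 1: "arr (neg f)" "src (neg f) = src f" "tgt (neg f) = tgt f"
    using a_inv_closed[of f] h by (simp_all add: hom_iff neg_def)
  show "Plus C f (neg f) = Zero C (src f) (tgt f)"
    using r_neg[of f] h by (simp add: neg_def)
  show "neg (neg f) = f"
    using minus_minus[of f] h 1 by (simp add: neg_def)
qed

lemma neg_unique:
  assumes "arr f" "arr g" "src f = src g" "tgt f = tgt g" "Plus C f g = Zero C (src g) (tgt g)"
  shows "g = neg f"
proof -
  interpret abelian_group "hom_grp C (src f) (tgt f)"
    using hom_abelian_group assms by simp
  show ?thesis
    using assms minus_equality[of g f] a_comm[of f g] by (simp add: hom_iff neg_def)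
qed

text \<open>Substitutes for subtraction: comparing two parallel maps becomes the study of
  \<open>d\<close> alone, so uniqueness questions turn into vanishing questions.\<close>

lemma difference:
  assumes "arr f" "arr g" "src f = src g" "tgt f = tgt g"
  obtains d where "arr d" "src d = src g" "tgt d = tgt g" "f = Plus C g d"
proof -
  interpret abelian_group "hom_grp C (src g) (tgt g)"
    using hom_abelian_group assms by simp
  have h: "f \<in> Hom C (src g) (tgt g)" "g \<in> Hom C (src g) (tgt g)"
    using assms by (simp_all add: hom_iff)
  have 1: "arr (neg g)" "src (neg g) = src g" "tgt (neg g) = tgt g"
    using assms by simp_all
  have "Plus C g (Plus C (neg g) f) = f"
    using r_neg2[of g f] h by (simp add: neg_def)
  then show thesis
    using that[of "Plus C (neg g) f"] 1 assms by simp
qed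

lemma cmp_plus:
  assumes "arr f" "arr g" "src f = src g" "tgt f = tgt g" "arr h"
  shows "src h = tgt g \<Longrightarrow> h \<cdot> Plus C f g = Plus C (h \<cdot> f) (h \<cdot> g)"
    and "tgt h = src g \<Longrightarrow> Plus C f g \<cdot> h = Plus C (f \<cdot> h) (g \<cdot> h)"
  using cmp_plus_right[of f "src g" "tgt g" g h "tgt h"] cmp_plus_left[of h "src h" "src g" f "tgt g" g] assms
  by (simp_all add: hom_iff)

lemma cmp_zero [simp]:
  assumes "arr h"
  shows "x \<in> Ob C \<Longrightarrow> src h = y \<Longrightarrow> h \<cdot> Zero C x y = Zero C x (tgt h)"
    and "y \<in> Ob C \<Longrightarrow> tgt h = x \<Longrightarrow> Zero C x y \<cdot> h = Zero C (src h) y"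
proof -
  assume x: "x \<in> Ob C" "src h = y"
  let ?z = "Zero C x y"
  have "Plus C ?z ?z = ?z"
    using x assms by (intro plus_zero) auto
  then have "Plus C (h \<cdot> ?z) (h \<cdot> ?z) = h \<cdot> ?z"
    using x assms cmp_plus(1)[of ?z ?z h] by auto
  then show "h \<cdot> ?z = Zero C x (tgt h)"
    using plus_cancel[of "h \<cdot> ?z" "h \<cdot> ?z"] x assms by auto
next
  assume x: "y \<in> Ob C" "tgt h = x"
  let ?z = "Zero C x y"
  have "Plus C ?z ?z = ?z"
    using x assms by (intro plus_zero) auto
  then have "Plus C (?z \<cdot> h) (?z \<cdot> h) = ?z \<cdot> h"
    using x assms cmp_plus(2)[of ?z ?z h] by auto
  then show "?z \<cdot> h = Zero C (src h) y"
    using plus_cancel[of "?z \<cdot> h" "?z \<cdot> h"] x assms by auto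
qed

lemma cmp_neg:
  assumes "arr f" "arr g" "tgt f = src g"
  shows "g \<cdot> neg f = neg (g \<cdot> f)" "neg g \<cdot> f = neg (g \<cdot> f)"
proof -
  have "Plus C (g \<cdot> f) (g \<cdot> neg f) = g \<cdot> Plus C f (neg f)"
    by (subst cmp_plus(1)) (use assms in simp_all)
  then have "Plus C (g \<cdot> f) (g \<cdot> neg f) = Zero C (src f) (tgt g)"
    using assms by (simp only: plus_neg) simp
  then show "g \<cdot> neg f = neg (g \<cdot> f)"
    by (intro neg_unique) (use assms in simp_all)
  have "Plus C (g \<cdot> f) (neg g \<cdot> f) = Plus C g (neg g) \<cdot> f"
    by (subst cmp_plus(2)) (use assms in simp_all)
  then have "Plus C (g \<cdot> f) (neg g \<cdot> f) = Zero C (src f) (tgt g)"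
    using assms by (simp only: plus_neg) simp
  then show "neg g \<cdot> f = neg (g \<cdot> f)"
    by (intro neg_unique) (use assms in simp_all)
qed

lemma neg_zero [simp]: "x \<in> Ob C \<Longrightarrow> y \<in> Ob C \<Longrightarrow> neg (Zero C x y) = Zero C x y"
  using neg_unique[of "Zero C x y" "Zero C x y"] plus_zero[of "Zero C x y" "Zero C x y"] by simp

lemma neg_inject: "neg f = neg g \<Longrightarrow> arr f \<Longrightarrow> arr g \<Longrightarrow> f = g"
  by (metis neg_neg)

lemma neg_eq_zero_iff: "arr f \<Longrightarrow> neg f = Zero C (src f) (tgt f) \<longleftrightarrow> f = Zero C (src f) (tgt f)"
  by (metis neg_neg neg_zero src_ob tgt_ob)

section \<open>Zero objects, kernels and cokernels\<close>

lemma is_zero_ob_hom: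
  assumes "is_zero_ob C z" "arr f"
  shows "src f = z \<Longrightarrow> f = Zero C z (tgt f)" "tgt f = z \<Longrightarrow> f = Zero C (src f) z"
  using assms unfolding is_zero_ob_def
  by (metis arr_Zero hom_iff src_ob tgt_ob)+

lemma is_zero_obI:
  assumes "z \<in> Ob C" "Ident C z = Zero C z z"
  shows "is_zero_ob C z"
proof -
  have "f = Zero C z x" if "f \<in> Hom C z x" for f x
    using that assms ident_simps(2)[of f z] cmp_zero(1)[of f z z] by (auto simp: hom_iff)
  moreover have "f = Zero C x z" if "f \<in> Hom C x z" for f x
    using that assms ident_simps(1)[of f z] cmp_zero(2)[of f z z] by (auto simp: hom_iff)
  ultimately show ?thesis
    unfolding is_zero_ob_def using assms
    by (metis arr_Zero hom_iff)
qed

text \<open>Two factorisations through \<open>k\<close> differ by a map that \<open>k\<close> kills.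
  Hence it is enough to check existence and that \<open>k\<close> kills only zero maps.\<close>

lemma is_kernelI:
  assumes f: "f \<in> Hom C x y" and k: "k \<in> Hom C w x" and fk: "f \<cdot> k = Zero C w y"
    and ex: "\<And>u v. v \<in> Hom C u x \<Longrightarrow> f \<cdot> v = Zero C u y \<Longrightarrow> \<exists>t \<in> Hom C u w. k \<cdot> t = v"
    and mono: "\<And>u t. t \<in> Hom C u w \<Longrightarrow> k \<cdot> t = Zero C u x \<Longrightarrow> t = Zero C u w"
  shows "is_kernel C f k"
proof -
  have "t = s" if "t \<in> Hom C u w" "s \<in> Hom C u w" "k \<cdot> t = k \<cdot> s" for t s u
  proof -
    obtain d where d: "arr d" "src d = u" "tgt d = w" "t = Plus C s d"
      using difference[of t s] \<open>t \<in> Hom C u w\<close> \<open>s \<in> Hom C u w\<close> by (auto simp: hom_iff)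
    have "k \<cdot> d = Zero C u x"
      using d that k cmp_plus(1)[of s d k] plus_cancel[of "k \<cdot> s" "k \<cdot> d"] by (auto simp: hom_iff)
    then have "d = Zero C u w"
      using d mono[of d u] by (simp add: hom_iff)
    then show ?thesis
      using d that plus_zero[of s d] by (auto simp: hom_iff)
  qed
  then have "\<forall>u. \<forall>v \<in> Hom C u x. f \<cdot> v = Zero C u y \<longrightarrow> (\<exists>!t. t \<in> Hom C u w \<and> k \<cdot> t = v)"
    using ex by blast
  then show ?thesis
    unfolding is_kernel_def using f k fk by blast
qed

lemma is_kernelD:
  assumes "is_kernel C f k"
  shows "arr f" "arr k" "tgt k = src f" "f \<cdot> k = Zero C (src k) (tgt f)"
    and "\<And>u v. v \<in> Hom C u (src f) \<Longrightarrow> f \<cdot> v = Zero C u (tgt f) \<Longrightarrow> \<exists>t \<in> Hom C u (src k). k \<cdot> t = v"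
    and "\<And>u t. t \<in> Hom C u (src k) \<Longrightarrow> k \<cdot> t = Zero C u (tgt k) \<Longrightarrow> t = Zero C u (src k)"
proof -
  obtain w x y where *: "f \<in> Hom C x y" "k \<in> Hom C w x" "f \<cdot> k = Zero C w y"
     "\<forall>u. \<forall>v \<in> Hom C u x. f \<cdot> v = Zero C u y \<longrightarrow> (\<exists>!t. t \<in> Hom C u w \<and> k \<cdot> t = v)"
    using assms unfolding is_kernel_def by blast
  have [simp]: "arr f" "arr k" "src f = x" "tgt f = y" "src k = w" "tgt k = x"
    using * by (simp_all add: hom_iff)
  show "arr f" "arr k" "tgt k = src f" "f \<cdot> k = Zero C (src k) (tgt f)"
    using * by simp_all
  show "\<exists>t \<in> Hom C u (src k). k \<cdot> t = v" if "v \<in> Hom C u (src f)" "f \<cdot> v = Zero C u (tgt f)" for u v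
    using *(4) that by simp blast
  show "t = Zero C u (src k)" if "t \<in> Hom C u (src k)" "k \<cdot> t = Zero C u (tgt k)" for u t
  proof -
    have u: "u \<in> Ob C" "w \<in> Ob C" "x \<in> Ob C" "y \<in> Ob C"
      using that(1) *(1,2) hom_ob by auto
    have "Zero C u w \<in> Hom C u w" "Zero C u x \<in> Hom C u x"
      using u by (simp_all add: hom_iff)
    moreover have "k \<cdot> Zero C u w = Zero C u x" "f \<cdot> Zero C u x = Zero C u y"
      using u by simp_all
    ultimately show ?thesis
      using *(4) that by (auto dest!: spec[of _ u])
  qed
qed

lemma is_cokernelI:
  assumes f: "f \<in> Hom C x y" and p: "p \<in> Hom C y w" and pf: "p \<cdot> f = Zero C x w"
    and ex: "\<And>u v. v \<in> Hom C y u \<Longrightarrow> v \<cdot> f = Zero C x u \<Longrightarrow> \<exists>t \<in> Hom C w u. t \<cdot> p = v"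
    and epi: "\<And>u t. t \<in> Hom C w u \<Longrightarrow> t \<cdot> p = Zero C y u \<Longrightarrow> t = Zero C w u"
  shows "is_cokernel C f p"
proof -
  have "t = s" if "t \<in> Hom C w u" "s \<in> Hom C w u" "t \<cdot> p = s \<cdot> p" for t s u
  proof -
    obtain d where d: "arr d" "src d = w" "tgt d = u" "t = Plus C s d"
      using difference[of t s] \<open>t \<in> Hom C w u\<close> \<open>s \<in> Hom C w u\<close> by (auto simp: hom_iff)
    have "d \<cdot> p = Zero C y u"
      using d that p cmp_plus(2)[of s d p] plus_cancel[of "s \<cdot> p" "d \<cdot> p"] by (auto simp: hom_iff)
    then have "d = Zero C w u"
      using d epi[of d u] by (simp add: hom_iff)
    then show ?thesis
      using d that plus_zero[of s d] by (auto simp: hom_iff)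
  qed
  then have "\<forall>u. \<forall>v \<in> Hom C y u. v \<cdot> f = Zero C x u \<longrightarrow> (\<exists>!t. t \<in> Hom C w u \<and> t \<cdot> p = v)"
    using ex by blast
  then show ?thesis
    unfolding is_cokernel_def using f p pf by blast
qed

lemma is_cokernelD:
  assumes "is_cokernel C f p"
  shows "arr f" "arr p" "src p = tgt f" "p \<cdot> f = Zero C (src f) (tgt p)"
    and "\<And>u v. v \<in> Hom C (tgt f) u \<Longrightarrow> v \<cdot> f = Zero C (src f) u \<Longrightarrow> \<exists>t \<in> Hom C (tgt p) u. t \<cdot> p = v"
    and "\<And>u t. t \<in> Hom C (tgt p) u \<Longrightarrow> t \<cdot> p = Zero C (src p) u \<Longrightarrow> t = Zero C (tgt p) u"
proof -
  obtain x y w where *: "f \<in> Hom C x y" "p \<in> Hom C y w" "p \<cdot> f = Zero C x w"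
     "\<forall>u. \<forall>v \<in> Hom C y u. v \<cdot> f = Zero C x u \<longrightarrow> (\<exists>!t. t \<in> Hom C w u \<and> t \<cdot> p = v)"
    using assms unfolding is_cokernel_def by blast
  have [simp]: "arr f" "arr p" "src f = x" "tgt f = y" "src p = y" "tgt p = w"
    using * by (simp_all add: hom_iff)
  show "arr f" "arr p" "src p = tgt f" "p \<cdot> f = Zero C (src f) (tgt p)"
    using * by simp_all
  show "\<exists>t \<in> Hom C (tgt p) u. t \<cdot> p = v" if "v \<in> Hom C (tgt f) u" "v \<cdot> f = Zero C (src f) u" for u v
    using *(4) that by simp blast
  show "t = Zero C (tgt p) u" if "t \<in> Hom C (tgt p) u" "t \<cdot> p = Zero C (src p) u" for u t
  proof -
    have u: "u \<in> Ob C" "w \<in> Ob C" "x \<in> Ob C" "y \<in> Ob C"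
      using that(1) *(1,2) hom_ob by auto
    have "Zero C w u \<in> Hom C w u" "Zero C y u \<in> Hom C y u"
      using u by (simp_all add: hom_iff)
    moreover have "Zero C w u \<cdot> p = Zero C y u" "Zero C y u \<cdot> f = Zero C x u"
      using u by simp_all
    ultimately show ?thesis
      using *(4) that by (auto dest!: spec[of _ u])
  qed
qed

text \<open>Since \<open>g\<close> kills \<open>k\<close>, it factors as \<open>t \<cdot> p\<close>.
  Whatever \<open>p\<close> kills is then killed by \<open>g\<close> and so factors through
  \<open>k\<close>.\<close>

lemma kernel_of_cokernel:
  assumes k: "is_kernel C g k" and p: "is_cokernel C k p"
  shows "is_kernel C p k"
proof -
  note K = is_kernelD[OF k] and P = is_cokernelD[OF p]
  obtain t where t: "t \<in> Hom C (tgt p) (tgt g)" "t \<cdot> p = g"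
    using P(5)[of g "tgt g"] K(1-4) by (auto simp: hom_iff)
  show ?thesis
  proof (rule is_kernelI)
    show "p \<in> Hom C (src p) (tgt p)" "k \<in> Hom C (src k) (src p)" "p \<cdot> k = Zero C (src k) (tgt p)"
      using P K by (simp_all add: hom_iff)
    show "\<exists>t \<in> Hom C u (src k). k \<cdot> t = v" if "v \<in> Hom C u (src p)" "p \<cdot> v = Zero C u (tgt p)" for u v
    proof (rule K(5))
      show "v \<in> Hom C u (src g)"
        using that(1) P K by simp
      have "t \<cdot> (p \<cdot> v) = g \<cdot> v"
        using that(1) t P by (intro reassoc) (auto simp: hom_iff)
      moreover have "t \<cdot> (p \<cdot> v) = Zero C u (tgt g)"
        using that t by (auto simp: hom_iff)
      ultimately show "g \<cdot> v = Zero C u (tgt g)" by simp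
    qed
    show "t = Zero C u (src k)" if "t \<in> Hom C u (src k)" "k \<cdot> t = Zero C u (src p)" for u t
      using K that P by simp
  qed
qed

lemma cokernel_of_kernel:
  assumes p: "is_cokernel C g p" and k: "is_kernel C p k"
  shows "is_cokernel C k p"
proof -
  note K = is_kernelD[OF k] and P = is_cokernelD[OF p]
  obtain t where t: "t \<in> Hom C (src g) (src k)" "k \<cdot> t = g"
    using K(5)[of g "src g"] P(1-4) by (auto simp: hom_iff)
  show ?thesis
  proof (rule is_cokernelI)
    show "p \<in> Hom C (tgt k) (tgt p)" "k \<in> Hom C (src k) (tgt k)" "p \<cdot> k = Zero C (src k) (tgt p)"
      using P K by (simp_all add: hom_iff)
    show "\<exists>t \<in> Hom C (tgt p) u. t \<cdot> p = v" if "v \<in> Hom C (tgt k) u" "v \<cdot> k = Zero C (src k) u" for u v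
    proof (rule P(5))
      show "v \<in> Hom C (tgt g) u"
        using that(1) P K by simp
      have "v \<cdot> g = (v \<cdot> k) \<cdot> t"
        using that(1) t K by (auto simp: hom_iff assoc)
      then show "v \<cdot> g = Zero C (src g) u"
        using that t by (auto simp: hom_iff)
    qed
    show "t = Zero C (tgt p) u" if "t \<in> Hom C (tgt p) u" "t \<cdot> p = Zero C (tgt k) u" for u t
      using P that K by simp
  qed
qed

text \<open>The zero map from \<open>z\<close> has the identity of \<open>x\<close> as cokernel, so
  its image is the kernel of an identity. That kernel is again \<open>Zero C z x\<close>, which is
  also a kernel of \<open>f\<close> because \<open>f\<close> kills only zero maps.\<close>

lemma exact_at_zero_left:
  assumes z: "is_zero_ob C z" and f: "f \<in> Hom C x y"
    and mono: "\<And>u t. t \<in> Hom C u x \<Longrightarrow> f \<cdot> t = Zero C u y \<Longrightarrow> t = Zero C u x"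
  shows "exact_at C (Zero C z x) f"
proof -
  have ob: "x \<in> Ob C" "y \<in> Ob C" "z \<in> Ob C"
    using f hom_ob z by (auto simp: is_zero_ob_def)
  have c: "is_cokernel C (Zero C z x) (Ident C x)"
    using ob by (intro is_cokernelI[where x = z and y = x and w = x]) (auto simp: hom_iff)
  \<comment> \<open>Stated for a general \<open>g\<close>, since it is applied both to the identity
    and to \<open>f\<close>.\<close>
  have *: "is_kernel C g (Zero C z x)"
    if g: "arr g" "src g = x"
      and m: "\<And>u t. t \<in> Hom C u x \<Longrightarrow> g \<cdot> t = Zero C u (tgt g) \<Longrightarrow> t = Zero C u x" for g
  proof (rule is_kernelI[where x = x and y = "tgt g" and w = z])
    show "\<exists>t\<in>Hom C u z. Zero C z x \<cdot> t = v" if "v \<in> Hom C u x" "g \<cdot> v = Zero C u (tgt g)" for u v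
    proof -
      have "u \<in> Ob C" using that(1) hom_ob by auto
      then show ?thesis
        using m[OF that] ob by (intro bexI[of _ "Zero C u z"]) (auto simp: hom_iff)
    qed
    show "t = Zero C u z" if "t \<in> Hom C u z" for u t
      using is_zero_ob_hom(2)[OF z, of t] that by (auto simp: hom_iff)
  qed (use g ob in \<open>auto simp: hom_iff\<close>)
  have "is_kernel C (Ident C x) (Zero C z x)"
    using ob by (intro *) (auto simp: hom_iff)
  moreover have "is_kernel C f (Zero C z x)"
    using f mono by (intro *) (auto simp: hom_iff)
  ultimately show ?thesis
    unfolding exact_at_def is_image_def using c f ob
    by (metis arr_Zero hom_iff)
qed

text \<open>Here \<open>Zero C y z\<close> is a cokernel of \<open>f\<close> with the identity of
  \<open>y\<close> as kernel, so the identity is both the image of \<open>f\<close> and the kernel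
  of the next map.\<close>

lemma exact_at_zero_right:
  assumes z: "is_zero_ob C z" and f: "f \<in> Hom C x y"
    and epi: "\<And>u t. t \<in> Hom C y u \<Longrightarrow> t \<cdot> f = Zero C x u \<Longrightarrow> t = Zero C y u"
  shows "exact_at C f (Zero C y z)"
proof -
  have ob: "x \<in> Ob C" "y \<in> Ob C" "z \<in> Ob C"
    using f hom_ob z by (auto simp: is_zero_ob_def)
  have c: "is_kernel C (Zero C y z) (Ident C y)"
    using ob by (intro is_kernelI[where x = y and y = z and w = y]) (auto simp: hom_iff)
  have "is_cokernel C f (Zero C y z)"
  proof (rule is_cokernelI[OF f])
    show "\<exists>t\<in>Hom C z u. t \<cdot> Zero C y z = v" if "v \<in> Hom C y u" "v \<cdot> f = Zero C x u" for u v
    proof -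
      have "u \<in> Ob C" using that(1) hom_ob by auto
      then show ?thesis
        using epi[OF that] ob by (intro bexI[of _ "Zero C z u"]) (auto simp: hom_iff)
    qed
    show "t = Zero C z u" if "t \<in> Hom C z u" for u t
      using is_zero_ob_hom(1)[OF z, of t] that by (auto simp: hom_iff)
  qed (use f ob in \<open>auto simp: hom_iff\<close>)
  then show ?thesis
    unfolding exact_at_def is_image_def using c f ob
    by (metis arr_Zero hom_iff)
qed

end

context additive_category
begin

lemma zero_ob_exists: "\<exists>z. is_zero_ob C z"
proof -
  \<comment> \<open>The identity of a direct sum of no objects is an empty sum, hence zero. The
    family is never evaluated, so \<open>undefined\<close> serves.\<close>
  obtain z where "is_direct_sum C 0 (\<lambda>_. undefined) z"
    using direct_sum_exists[of 0 "\<lambda>_. undefined"] by auto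
  then have z: "z \<in> Ob C" "\<exists>\<iota> \<pi>. finsum (hom_grp C z z) (\<lambda>i. \<iota> i \<cdot> \<pi> i) ({} :: nat set) = Ident C z"
    by (auto simp: is_direct_sum_def)
  interpret abelian_group "hom_grp C z z"
    using hom_abelian_group z by simp
  show ?thesis
    using z is_zero_obI[of z] by auto
qed

end

context abelian_category
begin

text \<open>A kernel is the kernel of its own cokernel, hence its own image.\<close>

lemma exact_at_kernel:
  assumes "is_kernel C g k"
  shows "exact_at C k g"
proof -
  note K = is_kernelD[OF assms]
  obtain p where "is_cokernel C k p"
    using cokernel_exists[OF arr_hom] K(2) by blast
  then show ?thesis
    unfolding exact_at_def is_image_def
    using kernel_of_cokernel[OF assms] assms K by (metis hom_iff)
qed

lemma exact_at_cokernel: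
  assumes "is_cokernel C f p"
  shows "exact_at C f p"
proof -
  note P = is_cokernelD[OF assms]
  obtain k where "is_kernel C p k"
    using kernel_exists[OF arr_hom] P(2) by blast
  then show ?thesis
    unfolding exact_at_def is_image_def
    using assms P by (metis hom_iff)
qed

text \<open>Produces short exactness in the form in which properness of a subcategory is
  phrased.\<close>

lemma short_exactI:
  assumes k: "is_kernel C p k" and p: "is_cokernel C k p"
  shows "short_exact C k p"
proof -
  note K = is_kernelD[OF k] and P = is_cokernelD[OF p]
  obtain z where z: "is_zero_ob C z"
    using zero_ob_exists by blast
  have "exact_at C (Zero C z (src k)) k"
    using K by (intro exact_at_zero_left[OF z]) (auto intro: arr_hom)
  moreover have "exact_at C k p"
    using exact_at_kernel[OF k] .
  moreover have "exact_at C p (Zero C (tgt p) z)"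
    using P by (intro exact_at_zero_right[OF z]) (auto intro: arr_hom)
  ultimately have "exact_sequence C [Zero C z (src k), k, p, Zero C (tgt p) z]"
    unfolding exact_sequence_def by (auto simp: less_Suc_eq nth_Cons split: nat.splits)
  then show ?thesis
    unfolding short_exact_def using z K by (metis hom_iff)
qed

end

section \<open>Long exact Hom sequences\<close>

context triangulated_category
begin

section \<open>The suspension on morphisms\<close>

lemma SuspO_ob [simp]: "x \<in> Ob T \<Longrightarrow> SuspO T x \<in> Ob T"
  and SuspM_Ident [simp]: "x \<in> Ob T \<Longrightarrow> SuspM T (Ident T x) = Ident T (SuspO T x)"
  using susp_equivalence by (auto simp: is_equivalence_def is_functor_def)

lemma arr_SuspM [simp]:
  assumes "arr f"
  shows "arr (SuspM T f)" "src (SuspM T f) = SuspO T (src f)" "tgt (SuspM T f) = SuspO T (tgt f)"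
proof -
  have "SuspM T f \<in> Hom T (SuspO T (src f)) (SuspO T (tgt f))"
    using susp_equivalence arr_hom[OF assms] by (auto simp: is_equivalence_def is_functor_def)
  then show "arr (SuspM T f)" "src (SuspM T f) = SuspO T (src f)" "tgt (SuspM T f) = SuspO T (tgt f)"
    by (simp_all add: hom_iff)
qed

lemma SuspM_cmp:
  assumes "arr f" "arr g" "tgt f = src g"
  shows "SuspM T (g \<cdot> f) = SuspM T g \<cdot> SuspM T f"
proof -
  have "f \<in> Hom T (src f) (src g)" "g \<in> Hom T (src g) (tgt g)"
    using assms by (simp_all add: hom_iff)
  then show ?thesis
    using susp_equivalence unfolding is_equivalence_def is_functor_def by blast
qed

lemma SuspM_bij: "x \<in> Ob T \<Longrightarrow> y \<in> Ob T \<Longrightarrow>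
    bij_betw (SuspM T) (Hom T x y) (Hom T (SuspO T x) (SuspO T y))"
  using susp_equivalence by (auto simp: is_equivalence_def)

lemma SuspM_full:
  assumes "arr v" "src v = SuspO T x" "tgt v = SuspO T y" "x \<in> Ob T" "y \<in> Ob T"
  obtains u where "arr u" "src u = x" "tgt u = y" "v = SuspM T u"
proof -
  have "v \<in> SuspM T ` Hom T x y"
    using SuspM_bij[of x y] assms by (simp add: bij_betw_def hom_iff)
  then show thesis using that by (auto simp: hom_iff)
qed

lemma SuspM_faithful:
  assumes "arr f" "arr g" "src f = src g" "tgt f = tgt g" "SuspM T f = SuspM T g"
  shows "f = g"
  using SuspM_bij[of "src g" "tgt g"] assms by (auto simp: bij_betw_def hom_iff dest: inj_onD)

lemma SuspM_Zero [simp]: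
  assumes "x \<in> Ob T" "y \<in> Ob T"
  shows "SuspM T (Zero T x y) = Zero T (SuspO T x) (SuspO T y)"
proof -
  let ?z = "Zero T x y"
  have "Plus T ?z ?z = ?z"
    using assms by (intro plus_zero) auto
  then have "Plus T (SuspM T ?z) (SuspM T ?z) = SuspM T ?z"
    using susp_plus[of ?z x y ?z] assms by (simp add: hom_iff)
  then show ?thesis
    using plus_cancel[of "SuspM T ?z" "SuspM T ?z"] assms by simp
qed

lemma SuspM_zeroD:
  assumes "arr f" "SuspM T f = Zero T (SuspO T (src f)) (SuspO T (tgt f))"
  shows "f = Zero T (src f) (tgt f)"
  by (rule SuspM_faithful) (use assms in simp_all)

lemma is_zero_ob_SuspO: "is_zero_ob T z \<Longrightarrow> is_zero_ob T (SuspO T z)"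
proof -
  assume z: "is_zero_ob T z"
  then have "z \<in> Ob T" "Ident T z = Zero T z z"
    using is_zero_ob_hom(1)[of z "Ident T z"] by (auto simp: is_zero_ob_def)
  then show ?thesis
    using is_zero_obI[of "SuspO T z"] SuspM_Ident[of z] by simp
qed

section \<open>Rotation, fill-ins and exactness of Hom along a triangle\<close>

lemma tri_arr:
  assumes "(f, g, h) \<in> Tri T"
  shows "arr f" "arr g" "arr h" "src g = tgt f" "src h = tgt g" "tgt h = SuspO T (src f)"
  using tri_candidate[OF assms] unfolding is_candidate_def by (auto simp: hom_iff)

lemma rotate: "(f, g, h) \<in> Tri T \<Longrightarrow> (g, h, neg (SuspM T f)) \<in> Tri T"
  using tri_rotate[of f "src f" "tgt f" g "tgt g" h] tri_arr[of f g h]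
  by (simp add: neg_def hom_iff)

lemma fill:
  assumes "(f, g, h) \<in> Tri T" "(f', g', h') \<in> Tri T" "arr u" "arr v" "src u = src f" "tgt u = src f'"
    "src v = tgt f" "tgt v = tgt f'" "v \<cdot> f = f' \<cdot> u"
  obtains w where "arr w" "src w = tgt g" "tgt w = tgt g'" "w \<cdot> g = g' \<cdot> v" "SuspM T u \<cdot> h = h' \<cdot> w"
proof -
  have "\<exists>w. is_tri_morphism T (f, g, h) (f', g', h') u v w"
    using assms tri_fill[of f g h f' g' h' "src f" "tgt f" "src f'" "tgt f'" u v] tri_arr[OF assms(1)] tri_arr[OF assms(2)]
    by (simp add: hom_iff)
  then show thesis
    using that unfolding is_tri_morphism_def by (auto simp: hom_iff)
qed

text \<open>Comparing the identity triangle on \<open>src f\<close> with the given one yields a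
  fill-in that starts at a zero object, so \<open>g \<cdot> f\<close> factors through zero. The
  other composites come from rotated triangles, the last one up to a sign.\<close>

lemma tri_comp_zero:
  assumes t: "(f, g, h) \<in> Tri T"
  shows "g \<cdot> f = Zero T (src f) (tgt g)" "h \<cdot> g = Zero T (tgt f) (SuspO T (src f))"
    "SuspM T f \<cdot> h = Zero T (tgt g) (SuspO T (tgt f))"
proof -
  obtain z where z: "is_zero_ob T z"
    using zero_ob_exists by blast
  then have zo: "z \<in> Ob T" by (simp add: is_zero_ob_def)
  have *: "g \<cdot> f = Zero T (src f) (tgt g)" if t: "(f, g, h) \<in> Tri T" for f g h
  proof -
    note t' = tri_arr[OF t]
    obtain w where "arr w" "src w = z" "tgt w = tgt g" "w \<cdot> Zero T (src f) z = g \<cdot> f"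
      using fill[OF tri_ident[OF _ z, of "src f"] t, of "Ident T (src f)" f] t' zo by auto
    then show ?thesis
      using t' by simp
  qed
  note t' = tri_arr[OF t]
  show "g \<cdot> f = Zero T (src f) (tgt g)" using *[OF t] .
  show "h \<cdot> g = Zero T (tgt f) (SuspO T (src f))"
    using *[OF rotate[OF t]] t' by simp
  have "neg (SuspM T f \<cdot> h) = Zero T (tgt g) (SuspO T (tgt f))"
    using *[OF rotate[OF rotate[OF t]]] t' by (simp add: cmp_neg)
  then show "SuspM T f \<cdot> h = Zero T (tgt g) (SuspO T (tgt f))"
    using neg_eq_zero_iff[of "SuspM T f \<cdot> h"] t' by simp
qed

text \<open>The map is wanted in the first position, but the axiom fills in the third. Both
  triangles are therefore rotated; the fill-in is a map between suspensions, which full faithfulness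
  pulls back.\<close>

lemma lift_mid:
  assumes t: "(f, g, h) \<in> Tri T" and v: "arr v" "tgt v = tgt f" "g \<cdot> v = Zero T (src v) (tgt g)"
  obtains u where "arr u" "src u = src v" "tgt u = src f" "f \<cdot> u = v"
proof -
  note t' = tri_arr[OF t]
  obtain z where z: "is_zero_ob T z"
    using zero_ob_exists by blast
  then have zo: "z \<in> Ob T" by (simp add: is_zero_ob_def)
  let ?w = "src v"
  have "(Zero T ?w z, Zero T z (SuspO T ?w), neg (Ident T (SuspO T ?w))) \<in> Tri T"
    using rotate[OF tri_ident[OF _ z, of ?w]] v by simp
  from fill[OF this rotate[OF t], of v "Zero T z (tgt g)"] obtain s where
    s: "arr s" "src s = SuspO T ?w" "tgt s = SuspO T (src f)"
      "SuspM T v \<cdot> neg (Ident T (SuspO T ?w)) = neg (SuspM T f) \<cdot> s"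
    using v t' zo by auto
  then have "neg (SuspM T v) = neg (SuspM T f \<cdot> s)"
    using v t' by (simp add: cmp_neg)
  then have e: "SuspM T v = SuspM T f \<cdot> s"
    by (rule neg_inject) (use s v t' in simp_all)
  obtain u where u: "arr u" "src u = ?w" "tgt u = src f" "s = SuspM T u"
    using SuspM_full[OF s(1-3)] v t' by auto
  have "f \<cdot> u = v"
    by (rule SuspM_faithful) (use u e v t' in \<open>simp_all add: SuspM_cmp\<close>)
  then show thesis using that u by blast
qed

lemma extend_mid:
  assumes t: "(f, g, h) \<in> Tri T" and v: "arr v" "src v = tgt f" "v \<cdot> f = Zero T (src f) (tgt v)"
  obtains u where "arr u" "src u = tgt g" "tgt u = tgt v" "u \<cdot> g = v"
proof -
  note t' = tri_arr[OF t]
  obtain z where z: "is_zero_ob T z"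
    using zero_ob_exists by blast
  then have zo: "z \<in> Ob T" by (simp add: is_zero_ob_def)
  let ?w = "tgt v"
  have w: "?w \<in> Ob T" using v by simp
  \<comment> \<open>With \<open>SuspO T z\<close> as the zero object, the third map is a negated
    suspension, so the triangle can be rotated back to one that starts at \<open>z\<close>.\<close>
  have "(Ident T ?w, Zero T ?w (SuspO T z), neg (SuspM T (Zero T z ?w))) \<in> Tri T"
    using tri_ident[OF w is_zero_ob_SuspO[OF z]] zo w by simp
  then have "(Zero T z ?w, Ident T ?w, Zero T ?w (SuspO T z)) \<in> Tri T"
    using tri_rotate[of "Zero T z ?w" z ?w "Ident T ?w" ?w "Zero T ?w (SuspO T z)"] zo w
    by (simp add: hom_iff neg_def)
  from fill[OF t this, of "Zero T (src f) z" v] obtain s where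
    "arr s" "src s = tgt g" "tgt s = ?w" "s \<cdot> g = Ident T ?w \<cdot> v"
    using v t' zo w by auto
  then show thesis using that v by simp
qed

text \<open>This and the following lemmas treat the remaining positions by rotating. A sign on a map
  occurring in a vanishing hypothesis is harmless; a sign on a factor is absorbed by passing to
  \<open>neg u\<close>.\<close>

lemma lift_end:
  assumes t: "(f, g, h) \<in> Tri T" and v: "arr v" "tgt v = tgt g" "h \<cdot> v = Zero T (src v) (tgt h)"
  obtains u where "arr u" "src u = src v" "tgt u = tgt f" "g \<cdot> u = v"
  using lift_mid[OF rotate[OF t] v] tri_arr[OF t] that by auto

lemma extend_end:
  assumes t: "(f, g, h) \<in> Tri T" and v: "arr v" "src v = tgt g" "v \<cdot> g = Zero T (src g) (tgt v)"
  obtains u where "arr u" "src u = SuspO T (src f)" "tgt u = tgt v" "u \<cdot> h = v"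
  using extend_mid[OF rotate[OF t] v] tri_arr[OF t] that by auto

lemma lift_susp:
  assumes t: "(f, g, h) \<in> Tri T"
    and v: "arr v" "tgt v = SuspO T (src f)" "SuspM T f \<cdot> v = Zero T (src v) (SuspO T (tgt f))"
  obtains u where "arr u" "src u = src v" "tgt u = tgt g" "h \<cdot> u = v"
proof (rule lift_mid[OF rotate[OF rotate[OF t]]])
  note t' = tri_arr[OF t]
  show "neg (SuspM T f) \<cdot> v = Zero T (src v) (tgt (neg (SuspM T f)))"
    using v t' by (simp add: cmp_neg)
qed (use v tri_arr[OF t] that in simp_all)

lemma extend_susp:
  assumes t: "(f, g, h) \<in> Tri T"
    and v: "arr v" "src v = SuspO T (src f)" "v \<cdot> h = Zero T (tgt g) (tgt v)"
  obtains u where "arr u" "src u = SuspO T (tgt f)" "tgt u = tgt v" "u \<cdot> SuspM T f = v"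
proof -
  note t' = tri_arr[OF t]
  obtain u where u: "arr u" "src u = SuspO T (tgt f)" "tgt u = tgt v" "u \<cdot> neg (SuspM T f) = v"
    using extend_mid[OF rotate[OF rotate[OF t]]] v t' by auto
  then have "neg u \<cdot> SuspM T f = v"
    using t' by (simp add: cmp_neg)
  then show thesis using that[of "neg u"] u by simp
qed

lemma lift_susp_mid:
  assumes t: "(f, g, h) \<in> Tri T"
    and v: "arr v" "tgt v = SuspO T (tgt f)" "SuspM T g \<cdot> v = Zero T (src v) (SuspO T (tgt g))"
  obtains u where "arr u" "src u = src v" "tgt u = SuspO T (src f)" "SuspM T f \<cdot> u = v"
proof -
  note t' = tri_arr[OF t]
  obtain u where u: "arr u" "src u = src v" "tgt u = SuspO T (src f)" "neg (SuspM T f) \<cdot> u = v"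
    using lift_susp[OF rotate[OF t], of v] v t' by auto
  then have "SuspM T f \<cdot> neg u = v"
    using t' by (simp add: cmp_neg)
  then show thesis using that[of "neg u"] u by simp
qed

lemma extend_susp_mid:
  assumes t: "(f, g, h) \<in> Tri T"
    and v: "arr v" "src v = SuspO T (tgt f)" "v \<cdot> SuspM T f = Zero T (SuspO T (src f)) (tgt v)"
  obtains u where "arr u" "src u = SuspO T (tgt g)" "tgt u = tgt v" "u \<cdot> SuspM T g = v"
proof (rule extend_susp[OF rotate[OF t]])
  note t' = tri_arr[OF t]
  show "v \<cdot> neg (SuspM T f) = Zero T (tgt h) (tgt v)"
    using v t' by (simp add: cmp_neg)
qed (use v tri_arr[OF t] that in simp_all)

lemma extend_susp_end:
  assumes t: "(f, g, h) \<in> Tri T"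
    and v: "arr v" "src v = SuspO T (tgt g)" "v \<cdot> SuspM T g = Zero T (SuspO T (tgt f)) (tgt v)"
  obtains u where "arr u" "src u = SuspO T (SuspO T (src f))" "tgt u = tgt v" "u \<cdot> SuspM T h = v"
proof (rule extend_susp_mid[OF rotate[OF t]])
  show "v \<cdot> SuspM T g = Zero T (SuspO T (src g)) (tgt v)"
    using v tri_arr[OF t] by simp
qed (use v tri_arr[OF t] that in simp_all)

end

section \<open>Approximations by a proper abelian subcategory\<close>

locale proper_abelian_setting = triangulated_category T
  for T :: "('o, 'm, 'z) tricat_scheme" (structure) +
  fixes A :: "'o set"
  assumes proper: "proper_abelian_subcategory T A"
    and vanish: "i \<in> {1, 2} \<Longrightarrow> hom_vanish T A (desusp T i A)"
begin

section \<open>The abelian subcategory inside \<open>T\<close>\<close>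

lemma A_ob [simp]: "a \<in> A \<Longrightarrow> a \<in> Ob T"
  using proper unfolding proper_abelian_subcategory_def additive_subcategory_def by blast

lemma full_sub_simps [simp]:
  "Ob (full_sub T X) = X" "Ident (full_sub T X) = Ident T" "Cmp (full_sub T X) = Cmp T"
  "Zero (full_sub T X) = Zero T"
  by (simp_all add: full_sub_def)

lemma hom_full_sub_iff: "f \<in> Hom (full_sub T X) x y \<longleftrightarrow> arr f \<and> src f = x \<and> tgt f = y \<and> x \<in> X \<and> y \<in> X"
  by (auto simp: full_sub_def hom_iff)

interpretation B: abelian_category "full_sub T A"
  using proper by (simp add: proper_abelian_subcategory_def)

lemma full_sub_arr:
  "B.arr f \<longleftrightarrow> arr f \<and> src f \<in> A \<and> tgt f \<in> A"
  "B.arr f \<Longrightarrow> B.src f = src f" "B.arr f \<Longrightarrow> B.tgt f = tgt f"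
proof -
  show 1: "B.arr f \<longleftrightarrow> arr f \<and> src f \<in> A \<and> tgt f \<in> A"
    by (auto simp: B.arr_def hom_full_sub_iff)
  show "B.src f = src f" "B.tgt f = tgt f" if "B.arr f"
    using B.hom_arr[of f "src f" "tgt f"] that by (auto simp: 1 hom_full_sub_iff)
qed

text \<open>Phrased with \<open>arr\<close>, \<open>src\<close> and \<open>tgt\<close> of
  \<open>T\<close> instead of those of the interpretation \<open>B\<close>, so that later arguments
  move freely between \<open>A\<close> and objects outside it.\<close>

lemma full_kernelI:
  assumes "arr f" "arr k" "src f \<in> A" "tgt f \<in> A" "src k \<in> A" "tgt k = src f"
    and "f \<cdot> k = Zero T (src k) (tgt f)"
    and "\<And>v. arr v \<Longrightarrow> src v \<in> A \<Longrightarrow> tgt v = src f \<Longrightarrow> f \<cdot> v = Zero T (src v) (tgt f) \<Longrightarrow>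
      \<exists>t. arr t \<and> src t = src v \<and> tgt t = src k \<and> k \<cdot> t = v"
    and "\<And>t. arr t \<Longrightarrow> src t \<in> A \<Longrightarrow> tgt t = src k \<Longrightarrow> k \<cdot> t = Zero T (src t) (tgt k) \<Longrightarrow>
      t = Zero T (src t) (src k)"
  shows "is_kernel (full_sub T A) f k"
  using assms by (intro B.is_kernelI[where x = "src f" and y = "tgt f" and w = "src k"])
    (auto simp: hom_full_sub_iff Bex_def)

lemma full_kernelD:
  assumes "is_kernel (full_sub T A) f k"
  shows "arr f" "arr k" "src f \<in> A" "tgt f \<in> A" "src k \<in> A" "tgt k = src f"
    and "f \<cdot> k = Zero T (src k) (tgt f)"
    and "\<And>v. arr v \<Longrightarrow> src v \<in> A \<Longrightarrow> tgt v = src f \<Longrightarrow> f \<cdot> v = Zero T (src v) (tgt f) \<Longrightarrow>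
      \<exists>t. arr t \<and> src t = src v \<and> tgt t = src k \<and> k \<cdot> t = v"
    and "\<And>t. arr t \<Longrightarrow> src t \<in> A \<Longrightarrow> tgt t = src k \<Longrightarrow> k \<cdot> t = Zero T (src t) (tgt k) \<Longrightarrow>
      t = Zero T (src t) (src k)"
  using B.is_kernelD[OF assms] by (auto simp: full_sub_arr hom_full_sub_iff Bex_def)

lemma full_cokernelI:
  assumes "arr f" "arr p" "src f \<in> A" "tgt f \<in> A" "tgt p \<in> A" "src p = tgt f"
    and "p \<cdot> f = Zero T (src f) (tgt p)"
    and "\<And>v. arr v \<Longrightarrow> tgt v \<in> A \<Longrightarrow> src v = tgt f \<Longrightarrow> v \<cdot> f = Zero T (src f) (tgt v) \<Longrightarrow>
      \<exists>t. arr t \<and> src t = tgt p \<and> tgt t = tgt v \<and> t \<cdot> p = v"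
    and "\<And>t. arr t \<Longrightarrow> tgt t \<in> A \<Longrightarrow> src t = tgt p \<Longrightarrow> t \<cdot> p = Zero T (src p) (tgt t) \<Longrightarrow>
      t = Zero T (tgt p) (tgt t)"
  shows "is_cokernel (full_sub T A) f p"
  using assms by (intro B.is_cokernelI[where x = "src f" and y = "tgt f" and w = "tgt p"])
    (auto simp: hom_full_sub_iff Bex_def)

lemma full_cokernelD:
  assumes "is_cokernel (full_sub T A) f p"
  shows "arr f" "arr p" "src f \<in> A" "tgt f \<in> A" "tgt p \<in> A" "src p = tgt f"
    and "p \<cdot> f = Zero T (src f) (tgt p)"
    and "\<And>v. arr v \<Longrightarrow> tgt v \<in> A \<Longrightarrow> src v = tgt f \<Longrightarrow> v \<cdot> f = Zero T (src f) (tgt v) \<Longrightarrow>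
      \<exists>t. arr t \<and> src t = tgt p \<and> tgt t = tgt v \<and> t \<cdot> p = v"
    and "\<And>t. arr t \<Longrightarrow> tgt t \<in> A \<Longrightarrow> src t = tgt p \<Longrightarrow> t \<cdot> p = Zero T (src p) (tgt t) \<Longrightarrow>
      t = Zero T (tgt p) (tgt t)"
  using B.is_cokernelD[OF assms] by (auto simp: full_sub_arr hom_full_sub_iff Bex_def)

lemma full_kernel_exists: "arr f \<Longrightarrow> src f \<in> A \<Longrightarrow> tgt f \<in> A \<Longrightarrow> \<exists>k. is_kernel (full_sub T A) f k"
  by (rule B.kernel_exists) (simp add: hom_full_sub_iff)

lemma full_cokernel_exists: "arr f \<Longrightarrow> src f \<in> A \<Longrightarrow> tgt f \<in> A \<Longrightarrow> \<exists>p. is_cokernel (full_sub T A) f p"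
  by (rule B.cokernel_exists) (simp add: hom_full_sub_iff)

text \<open>Here properness enters: a kernel-cokernel pair in \<open>A\<close> acquires a third map
  and becomes a triangle, to which the Hom sequences of \<open>T\<close> apply.\<close>

lemma short_exact_tri:
  assumes k: "is_kernel (full_sub T A) p k" and p: "is_cokernel (full_sub T A) k p"
  shows "\<exists>h. (k, p, h) \<in> Tri T"
proof -
  note K = full_kernelD(1-6)[OF k] and P = full_cokernelD(1-6)[OF p]
  have "k \<in> Hom T (src k) (tgt k)" "p \<in> Hom T (tgt k) (tgt p)"
    using K(1-5) P by (simp_all add: hom_iff)
  then show ?thesis
    using B.short_exactI[OF k p] proper K P unfolding proper_abelian_subcategory_def by metis
qed

lemmas full_exact = B.exact_at_kernel B.exact_at_cokernel B.kernel_of_cokernel B.cokernel_of_kernel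

lemma full_zero_ob: "\<exists>z. is_zero_ob (full_sub T A) z"
  by (rule B.zero_ob_exists)

lemma full_exact_zero_left:
  assumes "is_zero_ob (full_sub T A) z" "is_kernel (full_sub T A) g k"
  shows "exact_at (full_sub T A) (Zero T z (src k)) k"
proof -
  note K = full_kernelD[OF assms(2)]
  show ?thesis
    using B.exact_at_zero_left[OF assms(1), of k "src k" "tgt k"] K by (simp add: hom_full_sub_iff)
qed

lemma full_exact_zero_right:
  assumes "is_zero_ob (full_sub T A) z" "is_cokernel (full_sub T A) g p"
  shows "exact_at (full_sub T A) p (Zero T (tgt p) z)"
proof -
  note P = full_cokernelD[OF assms(2)]
  show ?thesis
    using B.exact_at_zero_right[OF assms(1), of p "src p" "tgt p"] P by (simp add: hom_full_sub_iff)
qed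

section \<open>Vanishing of maps between suspensions of objects of \<open>A\<close>\<close>

definition hom_zero :: "'o \<Rightarrow> 'o \<Rightarrow> bool" where
  "hom_zero x y \<longleftrightarrow> (\<forall>f. arr f \<and> src f = x \<and> tgt f = y \<longrightarrow> f = Zero T x y)"

text \<open>The target is a suspension only up to isomorphism. Composing with \<open>j\<close> turns
  \<open>f\<close> into a map between suspensions, which fullness desuspends to a map from
  \<open>x\<close> to \<open>z\<close>; composing with \<open>i\<close> recovers
  \<open>f\<close>.\<close>

lemma hom_zero_susp:
  assumes hz: "hom_zero x z" and ob: "x \<in> Ob T" "z \<in> Ob T" and iso: "isomorphic T (SuspO T z) y"
  shows "hom_zero (SuspO T x) y"
  unfolding hom_zero_def
proof (intro allI impI, elim conjE)
  fix f assume f: "arr f" "src f = SuspO T x" "tgt f = y"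
  obtain i j where i: "arr i" "src i = SuspO T z" "tgt i = y"
    and j: "arr j" "src j = y" "tgt j = SuspO T z" "i \<cdot> j = Ident T y"
    using iso unfolding isomorphic_def is_isomorphism_iff by (auto simp: hom_iff)
  obtain u where u: "arr u" "src u = x" "tgt u = z" "j \<cdot> f = SuspM T u"
    using SuspM_full[of "j \<cdot> f" x z] f j ob by auto
  then have "u = Zero T x z"
    using hz by (simp add: hom_zero_def)
  then have "j \<cdot> f = Zero T (SuspO T x) (SuspO T z)"
    using u(4) ob by simp
  then have "i \<cdot> (j \<cdot> f) = Zero T (SuspO T x) y"
    using i ob by simp
  moreover have "i \<cdot> (j \<cdot> f) = f"
    using reassoc[OF j(4), of f] f i j by simp
  ultimately show "f = Zero T (SuspO T x) y" by simp
qed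

lemma desuspend: "y \<in> Ob T \<Longrightarrow> \<exists>z \<in> Ob T. isomorphic T (SuspO T z) y"
  using susp_equivalence by (auto simp: is_equivalence_def)

lemma hom_zero_desusp:
  assumes "i \<in> {1, 2}" "a \<in> A" "z \<in> desusp T i A"
  shows "hom_zero a z"
  using vanish[OF assms(1)] assms(2,3) unfolding hom_vanish_def hom_zero_def
  by (metis hom_iff singletonD)

lemma hom_zero_SA_A:
  assumes "a \<in> A" "a' \<in> A"
  shows "hom_zero (SuspO T a) a'"
proof -
  obtain z where z: "z \<in> Ob T" "isomorphic T (SuspO T z) a'"
    using desuspend[OF A_ob[OF assms(2)]] by blast
  then have "z \<in> desusp T 1 A"
    using assms by (auto simp: desusp_def)
  then have "hom_zero a z"
    using hom_zero_desusp[of 1] assms by simp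
  then show ?thesis
    using hom_zero_susp z assms by auto
qed

text \<open>Desuspending \<open>a'\<close> twice gives an object \<open>z\<close> of
  \<open>desusp T 2 A\<close>. The vanishing of maps from \<open>a\<close> to \<open>z\<close> is
  then suspended twice, back to \<open>a'\<close>.\<close>

lemma hom_zero_SSA_A:
  assumes "a \<in> A" "a' \<in> A"
  shows "hom_zero (SuspO T (SuspO T a)) a'"
proof -
  obtain y where y: "y \<in> Ob T" "isomorphic T (SuspO T y) a'"
    using desuspend[OF A_ob[OF assms(2)]] by blast
  obtain z where z: "z \<in> Ob T" "isomorphic T (SuspO T z) y"
    using desuspend[OF y(1)] by blast
  obtain i j where i: "arr i" "src i = SuspO T y" "tgt i = a'" "arr j" "src j = a'" "tgt j = SuspO T y"
     "i \<cdot> j = Ident T a'" "j \<cdot> i = Ident T (SuspO T y)"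
    using y unfolding isomorphic_def is_isomorphism_iff by (auto simp: hom_iff)
  obtain k l where k: "arr k" "src k = SuspO T z" "tgt k = y" "arr l" "src l = y" "tgt l = SuspO T z"
     "k \<cdot> l = Ident T y" "l \<cdot> k = Ident T (SuspO T z)"
    using z unfolding isomorphic_def is_isomorphism_iff by (auto simp: hom_iff)
  have kl: "SuspM T k \<cdot> SuspM T l = Ident T (SuspO T y)"
    and lk: "SuspM T l \<cdot> SuspM T k = Ident T (SuspO T (SuspO T z))"
    using k SuspM_cmp[of l k] SuspM_cmp[of k l] y z by auto
  \<comment> \<open>The isomorphism from \<open>SuspO T (SuspO T z)\<close> to \<open>a'\<close> is
    the suspension of \<open>k\<close> followed by \<open>i\<close>; these two equations exhibit its
    inverse.\<close>
  have 1: "(i \<cdot> SuspM T k) \<cdot> (SuspM T l \<cdot> j) = Ident T a'"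
    using i k reassoc[OF kl, of j] y by (simp add: assoc)
  have 2: "(SuspM T l \<cdot> j) \<cdot> (i \<cdot> SuspM T k) = Ident T (SuspO T (SuspO T z))"
    using i k reassoc[OF i(8), of "SuspM T k"] y lk by (simp add: assoc)
  have "is_isomorphism T (i \<cdot> SuspM T k)"
    unfolding is_isomorphism_iff using i k 1 2 by (auto intro!: exI[of _ "SuspM T l \<cdot> j"])
  then have "isomorphic T (SuspO T (SuspO T z)) a'"
    unfolding isomorphic_def using i k by (auto intro!: bexI[of _ "i \<cdot> SuspM T k"] simp: hom_iff)
  then have "z \<in> desusp T 2 A"
    using z assms by (auto simp: desusp_def numeral_2_eq_2)
  then have "hom_zero a z"
    using hom_zero_desusp[of 2] assms by simp
  then have "hom_zero (SuspO T a) y"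
    using hom_zero_susp z assms by auto
  then show ?thesis
    using hom_zero_susp y assms by auto
qed

lemma hom_zero_SSA_SA:
  assumes "a \<in> A" "a' \<in> A"
  shows "hom_zero (SuspO T (SuspO T a)) (SuspO T a')"
proof -
  have "isomorphic T (SuspO T a') (SuspO T a')"
    unfolding isomorphic_def using assms is_isomorphism_Ident[of "SuspO T a'"]
    by (auto intro!: bexI[of _ "Ident T (SuspO T a')"] simp: hom_iff)
  then show ?thesis
    using hom_zero_susp[of "SuspO T a" a'] hom_zero_SA_A assms by auto
qed

lemmas vanish_SA_A = hom_zero_SA_A[unfolded hom_zero_def, rule_format, OF _ _ conjI, OF _ _ _ conjI]
  and vanish_SSA_A = hom_zero_SSA_A[unfolded hom_zero_def, rule_format, OF _ _ conjI, OF _ _ _ conjI]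
  and vanish_SSA_SA = hom_zero_SSA_SA[unfolded hom_zero_def, rule_format, OF _ _ conjI, OF _ _ _ conjI]

text \<open>The object \<open>a\<close> is an argument because the suspension need not be injective
  on objects, so \<open>src \<phi>\<close> fixes it only up to isomorphism. The other endpoints are
  read off the morphisms.\<close>

definition extension_tri :: "'o \<Rightarrow> 'm \<Rightarrow> 'm \<Rightarrow> 'm \<Rightarrow> bool" where
  "extension_tri a \<phi> \<psi> \<chi> \<longleftrightarrow> (\<phi>, \<psi>, \<chi>) \<in> Tri T \<and> a \<in> A \<and> src \<phi> = SuspO T a \<and> tgt \<psi> \<in> A"

section \<open>Consequences of a single extension triangle\<close>

context
  fixes a \<phi> \<psi> \<chi>
  assumes ext: "extension_tri a \<phi> \<psi> \<chi>"
begin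

lemma ext_tri: "(\<phi>, \<psi>, \<chi>) \<in> Tri T" "a \<in> A" "src \<phi> = SuspO T a" "tgt \<psi> \<in> A"
  using ext by (auto simp: extension_tri_def)

lemma ext_arr: "arr \<phi>" "arr \<psi>" "arr \<chi>" "src \<psi> = tgt \<phi>" "src \<chi> = tgt \<psi>"
    "tgt \<chi> = SuspO T (SuspO T a)"
  using tri_arr[OF ext_tri(1)] ext_tri by simp_all

text \<open>The only obstruction to lifting \<open>v\<close> is \<open>\<psi> \<cdot> v\<close>, a
  map from \<Sigma>A to A. The lift runs between suspensions and can be desuspended.\<close>

lemma approx_lift:
  assumes "arr v" "src v = SuspO T b" "b \<in> A" "tgt v = tgt \<phi>"
  obtains u where "arr u" "src u = b" "tgt u = a" "\<phi> \<cdot> SuspM T u = v"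
proof -
  have "\<psi> \<cdot> v = Zero T (SuspO T b) (tgt \<psi>)"
    using assms ext_tri ext_arr by (intro vanish_SA_A) auto
  then obtain s where s: "arr s" "src s = SuspO T b" "tgt s = SuspO T a" "\<phi> \<cdot> s = v"
    using lift_mid[OF ext_tri(1), of v] assms ext_tri by auto
  then show thesis
    using SuspM_full[OF s(1-3)] assms ext_tri that by auto
qed

text \<open>A map killed by \<open>\<phi>\<close> would come from a desuspension of
  \<open>tgt \<psi>\<close>. Suspending once more avoids this: the double suspension of
  \<open>u\<close> factors through \<open>\<chi>\<close> by a map from \<Sigma>\<Sigma>A to A, which
  is zero.\<close>

lemma approx_mono:
  assumes "arr u" "src u \<in> A" "tgt u = a" "\<phi> \<cdot> SuspM T u = Zero T (SuspO T (src u)) (tgt \<phi>)"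
  shows "u = Zero T (src u) a"
proof -
  have "SuspM T \<phi> \<cdot> SuspM T (SuspM T u) = SuspM T (\<phi> \<cdot> SuspM T u)"
    by (subst SuspM_cmp) (use assms ext_tri ext_arr in simp_all)
  also have "\<dots> = Zero T (SuspO T (SuspO T (src u))) (SuspO T (tgt \<phi>))"
    using assms ext_arr by simp
  finally obtain s where s: "arr s" "src s = SuspO T (SuspO T (src u))" "tgt s = tgt \<psi>"
      "\<chi> \<cdot> s = SuspM T (SuspM T u)"
    using lift_susp[OF ext_tri(1), of "SuspM T (SuspM T u)"] assms ext_tri by auto
  have "s = Zero T (SuspO T (SuspO T (src u))) (tgt \<psi>)"
    using s assms ext_tri by (intro vanish_SSA_A) auto
  then have "SuspM T (SuspM T u) = Zero T (SuspO T (SuspO T (src u))) (SuspO T (SuspO T a))"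
    using s ext_arr assms by auto
  then have "SuspM T u = Zero T (SuspO T (src u)) (SuspO T a)"
    using SuspM_zeroD[of "SuspM T u"] assms by simp
  then show ?thesis
    using SuspM_zeroD[of u] assms by simp
qed

lemma approx_extend:
  assumes "arr v" "src v = tgt \<phi>" "tgt v \<in> A"
  obtains u where "arr u" "src u = tgt \<psi>" "tgt u = tgt v" "u \<cdot> \<psi> = v"
proof (rule extend_mid[OF ext_tri(1) assms(1,2)])
  have "v \<cdot> \<phi> = Zero T (SuspO T a) (tgt v)"
    using assms ext_tri ext_arr by (intro vanish_SA_A) auto
  then show "v \<cdot> \<phi> = Zero T (src \<phi>) (tgt v)"
    using ext_tri by simp
qed (rule that)

text \<open>A map that vanishes on \<open>\<psi>\<close> factors through \<open>\<chi>\<close>, and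
  the other factor is a map from \<Sigma>\<Sigma>A to A.\<close>

lemma approx_epi:
  assumes "arr u" "src u = tgt \<psi>" "tgt u \<in> A" "u \<cdot> \<psi> = Zero T (tgt \<phi>) (tgt u)"
  shows "u = Zero T (tgt \<psi>) (tgt u)"
proof -
  obtain s where s: "arr s" "src s = SuspO T (SuspO T a)" "tgt s = tgt u" "s \<cdot> \<chi> = u"
    using extend_end[OF ext_tri(1), of u] assms ext_tri ext_arr by auto
  have "s = Zero T (SuspO T (SuspO T a)) (tgt u)"
    using s assms ext_tri by (intro vanish_SSA_A) auto
  then show ?thesis
    using s ext_arr assms by auto
qed

text \<open>Neither outer term of the triangle receives a nonzero map from \<Sigma>\<Sigma>A: the
  composite with \<open>\<psi>\<close> vanishes, and so does the resulting lift to
  \<Sigma>a.\<close>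

lemma vanish_SSA_ext:
  assumes "arr v" "src v = SuspO T (SuspO T b)" "b \<in> A" "tgt v = tgt \<phi>"
  shows "v = Zero T (src v) (tgt v)"
proof -
  have "\<psi> \<cdot> v = Zero T (SuspO T (SuspO T b)) (tgt \<psi>)"
    using assms ext_tri ext_arr by (intro vanish_SSA_A) auto
  then obtain s where s: "arr s" "src s = SuspO T (SuspO T b)" "tgt s = SuspO T a" "\<phi> \<cdot> s = v"
    using lift_mid[OF ext_tri(1), of v] assms ext_tri by auto
  have "s = Zero T (SuspO T (SuspO T b)) (SuspO T a)"
    using s assms ext_tri by (intro vanish_SSA_SA) auto
  then show ?thesis
    using s ext_arr ext_tri assms by auto
qed

text \<open>The same argument on the suspended triangle: the restriction to \<Sigma>\<Sigma>a
  vanishes, and so does the induced map on the suspension of \<open>tgt \<psi>\<close>.\<close>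

lemma vanish_Sext_A:
  assumes "arr v" "src v = SuspO T (tgt \<phi>)" "tgt v \<in> A"
  shows "v = Zero T (src v) (tgt v)"
proof -
  have "v \<cdot> SuspM T \<phi> = Zero T (SuspO T (SuspO T a)) (tgt v)"
    using assms ext_tri ext_arr by (intro vanish_SSA_A) auto
  then obtain s where s: "arr s" "src s = SuspO T (tgt \<psi>)" "tgt s = tgt v" "s \<cdot> SuspM T \<psi> = v"
    using extend_susp_mid[OF ext_tri(1), of v] assms ext_tri by auto
  have "s = Zero T (SuspO T (tgt \<psi>)) (tgt v)"
    using s assms ext_tri by (intro vanish_SA_A) auto
  then show ?thesis
    using s ext_arr ext_tri assms by auto
qed

lemma ext_min_right_approx: "min_right_approx T (SuspO T ` A) (SuspO T a) (tgt \<phi>) \<phi>"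
  unfolding min_right_approx_def right_approx_def
proof (intro conjI ballI impI)
  show "SuspO T a \<in> SuspO T ` A" "\<phi> \<in> Hom T (SuspO T a) (tgt \<phi>)"
    using ext_tri ext_arr by (auto simp: hom_iff)
  fix x v assume "x \<in> SuspO T ` A" "v \<in> Hom T x (tgt \<phi>)"
  then obtain b where b: "b \<in> A" "x = SuspO T b" "arr v" "src v = SuspO T b" "tgt v = tgt \<phi>"
    by (auto simp: hom_iff)
  then obtain u where "arr u" "src u = b" "tgt u = a" "\<phi> \<cdot> SuspM T u = v"
    using approx_lift[of v b] by auto
  then show "\<exists>\<theta>\<in>Hom T x (SuspO T a). \<phi> \<cdot> \<theta> = v"
    using b by (auto intro!: bexI[of _ "SuspM T u"] simp: hom_iff)
next
  fix e assume e: "e \<in> Hom T (SuspO T a) (SuspO T a)" "\<phi> \<cdot> e = \<phi>"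
  let ?i = "Ident T (SuspO T a)"
  have sa: "SuspO T a \<in> Ob T" using ext_tri by simp
  \<comment> \<open>Writing \<open>e\<close> as the identity plus \<open>d\<close> turns the
    condition on \<open>e\<close> into the vanishing of \<open>\<phi> \<cdot> d\<close>. Then
    \<open>d\<close> is zero, so \<open>e\<close> is not just invertible but the identity.\<close>
  obtain d where d: "arr d" "src d = SuspO T a" "tgt d = SuspO T a" "e = Plus T ?i d"
    using difference[of e ?i] e sa by (auto simp: hom_iff)
  obtain d' where d': "arr d'" "src d' = a" "tgt d' = a" "d = SuspM T d'"
    using SuspM_full[OF d(1-3)] ext_tri by auto
  have "\<phi> \<cdot> e = Plus T \<phi> (\<phi> \<cdot> d)"
    unfolding d(4) by (subst cmp_plus(1)) (use d(1-3) ext_arr(1,2) ext_tri(3) sa in simp_all)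
  then have "Plus T \<phi> (\<phi> \<cdot> d) = \<phi>"
    using e(2) by metis
  then have "\<phi> \<cdot> d = Zero T (SuspO T a) (tgt \<phi>)"
    by (rule plus_cancelD) (use d(1-3) ext_arr(1-4) ext_tri in simp_all)
  then have "d' = Zero T a a"
    using approx_mono[of d'] d' ext_tri by simp
  then have "e = ?i"
    unfolding d(4) d'(4) by (intro plus_zero) (use d'(1-3) sa ext_tri in simp_all)
  then show "is_isomorphism T e"
    using is_isomorphism_Ident[OF sa] by simp
qed

lemma ext_min_left_approx: "min_left_approx T A (tgt \<phi>) (tgt \<psi>) \<psi>"
  unfolding min_left_approx_def left_approx_def
proof (intro conjI ballI impI)
  show "tgt \<psi> \<in> A" "\<psi> \<in> Hom T (tgt \<phi>) (tgt \<psi>)"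
    using ext_tri ext_arr by (auto simp: hom_iff)
  fix x v assume "x \<in> A" "v \<in> Hom T (tgt \<phi>) x"
  then show "\<exists>\<theta>\<in>Hom T (tgt \<psi>) x. \<theta> \<cdot> \<psi> = v"
    using approx_extend[of v] by (auto simp: hom_iff Bex_def)
next
  fix e assume e: "e \<in> Hom T (tgt \<psi>) (tgt \<psi>)" "e \<cdot> \<psi> = \<psi>"
  let ?i = "Ident T (tgt \<psi>)"
  have sa: "tgt \<psi> \<in> Ob T" using ext_tri by simp
  obtain d where d: "arr d" "src d = tgt \<psi>" "tgt d = tgt \<psi>" "e = Plus T ?i d"
    using difference[of e ?i] e sa by (auto simp: hom_iff)
  have "e \<cdot> \<psi> = Plus T \<psi> (d \<cdot> \<psi>)"
    unfolding d(4) by (subst cmp_plus(2)) (use d(1-3) ext_arr(1,2) sa in simp_all)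
  then have "Plus T \<psi> (d \<cdot> \<psi>) = \<psi>"
    using e(2) by metis
  then have "d \<cdot> \<psi> = Zero T (tgt \<phi>) (tgt \<psi>)"
    by (rule plus_cancelD) (use d(1-3) ext_arr(1-4) in simp_all)
  then have "d = Zero T (tgt \<psi>) (tgt \<psi>)"
    using approx_epi[of d] d ext_tri by simp
  then have "e = ?i"
    unfolding d(4) by (intro plus_zero) (use d(1-3) sa ext_tri in simp_all)
  then show "is_isomorphism T e"
    using is_isomorphism_Ident[OF sa] by simp
qed

text \<open>Separately chosen minimal approximations of one object need a common triangle before Hom
  sequences apply. Uniqueness of both approximations transports the given triangle to them, with the
  identity in the middle.\<close>

lemma extension_tri_of_approx:
  assumes \<phi>': "min_right_approx T (SuspO T ` A) (SuspO T a') (tgt \<phi>) \<phi>'" and a': "a' \<in> A"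
    and \<psi>': "min_left_approx T A (tgt \<phi>) a\<^sub>0 \<psi>'"
  shows "\<exists>\<chi>'. extension_tri a' \<phi>' \<psi>' \<chi>'"
proof -
  have arrs: "arr \<phi>'" "src \<phi>' = SuspO T a'" "tgt \<phi>' = tgt \<phi>" "arr \<psi>'" "src \<psi>' = tgt \<phi>" "tgt \<psi>' = a\<^sub>0" "a\<^sub>0 \<in> A"
    using \<phi>' \<psi>' by (auto simp: min_right_approx_def right_approx_def min_left_approx_def left_approx_def hom_iff)
  obtain u where u: "arr u" "src u = SuspO T a" "tgt u = SuspO T a'" "is_isomorphism T u" "\<phi>' \<cdot> u = \<phi>"
    using min_right_approx_unique[OF ext_min_right_approx \<phi>'] by (auto simp: hom_iff)
  obtain w where w: "arr w" "src w = tgt \<psi>" "tgt w = a\<^sub>0" "is_isomorphism T w" "w \<cdot> \<psi> = \<psi>'"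
    using min_left_approx_unique[OF ext_min_left_approx \<psi>'] by (auto simp: hom_iff)
  obtain w' where w': "arr w'" "src w' = a\<^sub>0" "tgt w' = tgt \<psi>" "w' \<cdot> w = Ident T (tgt \<psi>)"
    using w unfolding is_isomorphism_iff by auto
  \<comment> \<open>The third map is \<open>\<chi>\<close> carried along the two comparison
    isomorphisms, with \<open>w'\<close> inverse to \<open>w\<close>.\<close>
  let ?\<chi> = "SuspM T u \<cdot> (\<chi> \<cdot> w')"
  have "is_tri_morphism T (\<phi>, \<psi>, \<chi>) (\<phi>', \<psi>', ?\<chi>) u (Ident T (tgt \<phi>)) w"
    unfolding is_tri_morphism_def prod.case
  proof (intro exI conjI)
    show "\<phi> \<in> Hom T (SuspO T a) (tgt \<phi>)" "\<psi> \<in> Hom T (tgt \<phi>) (tgt \<psi>)"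
      "\<chi> \<in> Hom T (tgt \<psi>) (SuspO T (SuspO T a))"
      using ext_arr ext_tri by (simp_all add: hom_iff)
    show "\<phi>' \<in> Hom T (SuspO T a') (tgt \<phi>)" "\<psi>' \<in> Hom T (tgt \<phi>) a\<^sub>0"
      "?\<chi> \<in> Hom T a\<^sub>0 (SuspO T (SuspO T a'))"
      using ext_arr arrs u w' by (simp_all add: hom_iff)
    show "u \<in> Hom T (SuspO T a) (SuspO T a')" "w \<in> Hom T (tgt \<psi>) a\<^sub>0"
      "Ident T (tgt \<phi>) \<in> Hom T (tgt \<phi>) (tgt \<phi>)"
      using ext_arr u w by (simp_all add: hom_iff)
    show "Ident T (tgt \<phi>) \<cdot> \<phi> = \<phi>' \<cdot> u" "w \<cdot> \<psi> = \<psi>' \<cdot> Ident T (tgt \<phi>)"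
      using ext_arr arrs u w by simp_all
    show "SuspM T u \<cdot> \<chi> = ?\<chi> \<cdot> w"
      using ext_arr u w w' by (simp add: assoc)
  qed
  then have "(\<phi>', \<psi>', ?\<chi>) \<in> Tri T"
    using tri_iso[OF ext_tri(1)] u w is_isomorphism_Ident[of "tgt \<phi>"] ext_arr by simp
  then show ?thesis
    unfolding extension_tri_def using a' arrs by blast
qed

end

abbreviation "E \<equiv> ext_product T (SuspO T ` A) A"

lemma E_extension_tri:
  assumes "c \<in> E"
  obtains a \<phi> \<psi> \<chi> where "extension_tri a \<phi> \<psi> \<chi>" "tgt \<phi> = c" "src \<psi> = c"
  using assms unfolding ext_product_def extension_tri_def by (auto simp: hom_iff)

end

section \<open>The approximation functors and the six-term sequence\<close>

text \<open>The four functions are arbitrary choices constrained only on \<open>E\<close>, so the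
  results hold for every choice of minimal approximations.\<close>

locale approx_functors = proper_abelian_setting T A
  for T :: "('o, 'm, 'z) tricat_scheme" (structure) and A +
  fixes F G :: "'o \<Rightarrow> 'o" and \<phi> \<psi> :: "'o \<Rightarrow> 'm"
  assumes F: "c \<in> E \<Longrightarrow> F c \<in> A \<and> min_right_approx T (SuspO T ` A) (SuspO T (F c)) c (\<phi> c)"
    and G: "c \<in> E \<Longrightarrow> G c \<in> A \<and> min_left_approx T A c (G c) (\<psi> c)"
begin

section \<open>Universal properties of the chosen approximations\<close>

lemma approx_arr [simp]:
  assumes "c \<in> E"
  shows "arr (\<phi> c)" "src (\<phi> c) = SuspO T (F c)" "tgt (\<phi> c) = c" "F c \<in> A"
    "arr (\<psi> c)" "src (\<psi> c) = c" "tgt (\<psi> c) = G c" "G c \<in> A"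
  using F[OF assms] G[OF assms]
  by (auto simp: min_right_approx_def right_approx_def min_left_approx_def left_approx_def hom_iff)

lemma approx_extension_tri:
  assumes "c \<in> E"
  obtains \<chi> where "extension_tri (F c) (\<phi> c) (\<psi> c) \<chi>" "(\<phi> c, \<psi> c, \<chi>) \<in> Tri T" "arr \<chi>" "src \<chi> = G c"
    "tgt \<chi> = SuspO T (SuspO T (F c))"
proof -
  obtain a \<phi>' \<psi>' \<chi>' where "extension_tri a \<phi>' \<psi>' \<chi>'" "tgt \<phi>' = c"
    using E_extension_tri[OF assms] .
  then obtain \<chi> where \<chi>: "extension_tri (F c) (\<phi> c) (\<psi> c) \<chi>"
    using extension_tri_of_approx F[OF assms] G[OF assms] by blast
  have "arr \<chi>" "src \<chi> = G c" "tgt \<chi> = SuspO T (SuspO T (F c))"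
    using ext_arr[OF \<chi>] assms by simp_all
  then show thesis
    using that[OF \<chi>] ext_tri(1)[OF \<chi>] by blast
qed

lemma E_ob [simp]: "c \<in> E \<Longrightarrow> c \<in> Ob T"
  using tgt_ob[of "\<phi> c"] by simp

lemma phi_lift:
  assumes "arr v" "src v = SuspO T b" "b \<in> A" "tgt v \<in> E"
  obtains u where "arr u" "src u = b" "tgt u = F (tgt v)" "\<phi> (tgt v) \<cdot> SuspM T u = v"
proof -
  obtain \<chi> where "extension_tri (F (tgt v)) (\<phi> (tgt v)) (\<psi> (tgt v)) \<chi>"
    using approx_extension_tri[OF assms(4)] .
  from approx_lift[OF this assms(1,2,3)] show thesis
    using that assms by auto
qed

lemma phi_mono:
  assumes "c \<in> E" "arr u" "src u \<in> A" "tgt u = F c" "\<phi> c \<cdot> SuspM T u = Zero T (SuspO T (src u)) c"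
  shows "u = Zero T (src u) (F c)"
proof -
  obtain \<chi> where "extension_tri (F c) (\<phi> c) (\<psi> c) \<chi>"
    using approx_extension_tri[OF assms(1)] .
  from approx_mono[OF this assms(2-4)] show ?thesis
    using assms by simp
qed

lemma psi_extend:
  assumes "arr v" "src v \<in> E" "tgt v \<in> A"
  obtains u where "arr u" "src u = G (src v)" "tgt u = tgt v" "u \<cdot> \<psi> (src v) = v"
proof -
  obtain \<chi> where "extension_tri (F (src v)) (\<phi> (src v)) (\<psi> (src v)) \<chi>"
    using approx_extension_tri[OF assms(2)] .
  from approx_extend[OF this assms(1) _ assms(3)] show thesis
    using that assms by auto
qed

lemma psi_epi:
  assumes "c \<in> E" "arr u" "src u = G c" "tgt u \<in> A" "u \<cdot> \<psi> c = Zero T c (tgt u)"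
  shows "u = Zero T (G c) (tgt u)"
proof -
  obtain \<chi> where "extension_tri (F c) (\<phi> c) (\<psi> c) \<chi>"
    using approx_extension_tri[OF assms(1)] .
  from approx_epi[OF this assms(2) _ assms(4)] show ?thesis
    using assms by simp
qed

lemma vanish_SSA_E:
  assumes "arr v" "src v = SuspO T (SuspO T b)" "b \<in> A" "tgt v \<in> E"
  shows "v = Zero T (src v) (tgt v)"
proof -
  obtain \<chi> where "extension_tri (F (tgt v)) (\<phi> (tgt v)) (\<psi> (tgt v)) \<chi>"
    using approx_extension_tri[OF assms(4)] .
  from vanish_SSA_ext[OF this assms(1-3)] show ?thesis
    using assms by simp
qed

lemma vanish_SE_A:
  assumes "arr v" "src v = SuspO T c" "c \<in> E" "tgt v \<in> A"
  shows "v = Zero T (src v) (tgt v)"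
proof -
  obtain \<chi> where "extension_tri (F c) (\<phi> c) (\<psi> c) \<chi>"
    using approx_extension_tri[OF assms(3)] .
  from vanish_Sext_A[OF this assms(1) _ assms(4)] show ?thesis
    using assms by simp
qed

text \<open>By additivity, \<open>\<phi> c\<close> kills the suspended difference, so
  \<open>phi_mono\<close> applies. This is the uniqueness behind the action of \<open>F\<close> on
  morphisms.\<close>

lemma phi_cancel:
  assumes "c \<in> E" "arr u" "arr u'" "src u' = src u" "src u \<in> A" "tgt u = F c" "tgt u' = F c"
    and eq: "\<phi> c \<cdot> SuspM T u = \<phi> c \<cdot> SuspM T u'"
  shows "u = u'"
proof -
  obtain d where d: "arr d" "src d = src u" "tgt d = F c" "u = Plus T u' d"
    using difference[of u u'] assms(1-7) by metis
  have "SuspM T u = Plus T (SuspM T u') (SuspM T d)"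
    unfolding d(4) by (rule susp_plus) (use d(1-3) assms(1-7) in \<open>simp_all add: hom_iff\<close>)
  then have "\<phi> c \<cdot> SuspM T u = Plus T (\<phi> c \<cdot> SuspM T u') (\<phi> c \<cdot> SuspM T d)"
    by (simp only:) (rule cmp_plus, use d(1-3) assms(1-7) in simp_all)
  then have "Plus T (\<phi> c \<cdot> SuspM T u') (\<phi> c \<cdot> SuspM T d) = \<phi> c \<cdot> SuspM T u'"
    using eq by metis
  then have "\<phi> c \<cdot> SuspM T d = Zero T (SuspO T (src d)) c"
    by (rule plus_cancelD) (use d(1-3) assms(1-7) in simp_all)
  then have "d = Zero T (src d) (F c)"
    by (intro phi_mono) (use d(1-3) assms(1-7) in simp_all)
  then show ?thesis
    unfolding d(4) by (intro plus_zero) (use d(1-3) assms(1-7) in simp_all)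
qed

lemma psi_cancel:
  assumes "c \<in> E" "arr u" "arr u'" "tgt u' = tgt u" "tgt u \<in> A" "src u = G c" "src u' = G c"
    and eq: "u \<cdot> \<psi> c = u' \<cdot> \<psi> c"
  shows "u = u'"
proof -
  obtain d where d: "arr d" "src d = G c" "tgt d = tgt u" "u = Plus T u' d"
    using difference[of u u'] assms(1-7) by metis
  have "u \<cdot> \<psi> c = Plus T (u' \<cdot> \<psi> c) (d \<cdot> \<psi> c)"
    unfolding d(4) by (rule cmp_plus) (use d(1-3) assms(1-7) in simp_all)
  then have "Plus T (u' \<cdot> \<psi> c) (d \<cdot> \<psi> c) = u' \<cdot> \<psi> c"
    using eq by metis
  then have "d \<cdot> \<psi> c = Zero T c (tgt d)"
    by (rule plus_cancelD) (use d(1-3) assms(1-7) in simp_all)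
  then have "d = Zero T (G c) (tgt d)"
    by (intro psi_epi) (use d(1-3) assms(1-7) in simp_all)
  then show ?thesis
    unfolding d(4) by (intro plus_zero) (use d(1-3) assms(1-7) in simp_all)
qed

section \<open>The action on morphisms and functoriality\<close>

lemma F_rel_ex1:
  assumes "c \<in> E" "c' \<in> E" "f \<in> Hom T c c'"
  shows "\<exists>!h. F_rel T F \<phi> c c' f h"
proof (rule ex_ex1I)
  have f: "arr f" "src f = c" "tgt f = c'"
    using assms by (simp_all add: hom_iff)
  obtain u where "arr u" "src u = F c" "tgt u = F c'" "\<phi> c' \<cdot> SuspM T u = f \<cdot> \<phi> c"
    using phi_lift[of "f \<cdot> \<phi> c" "F c"] f assms by auto
  then show "\<exists>h. F_rel T F \<phi> c c' f h"
    using f unfolding F_rel_def by (auto simp: hom_iff)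
  show "h = h'" if "F_rel T F \<phi> c c' f h" "F_rel T F \<phi> c c' f h'" for h h'
    using that assms by (simp add: F_rel_def hom_iff phi_cancel[of c'])
qed

lemma G_rel_ex1:
  assumes "c \<in> E" "c' \<in> E" "f \<in> Hom T c c'"
  shows "\<exists>!h. G_rel T G \<psi> c c' f h"
proof (rule ex_ex1I)
  have f: "arr f" "src f = c" "tgt f = c'"
    using assms by (simp_all add: hom_iff)
  obtain u where "arr u" "src u = G c" "tgt u = G c'" "u \<cdot> \<psi> c = \<psi> c' \<cdot> f"
    using psi_extend[of "\<psi> c' \<cdot> f"] f assms by auto
  then show "\<exists>h. G_rel T G \<psi> c c' f h"
    using f unfolding G_rel_def by (auto simp: hom_iff)
  show "h = h'" if "G_rel T G \<psi> c c' f h" "G_rel T G \<psi> c c' f h'" for h h'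
    using that assms by (simp add: G_rel_def hom_iff psi_cancel[of c])
qed

abbreviation "Fm \<equiv> F_mor T F \<phi>"
abbreviation "Gm \<equiv> G_mor T G \<psi>"

text \<open>The description in \<open>F_mor\<close> also quantifies over endpoints. Disjointness of
  Hom sets forces them to be those of \<open>f\<close>, and then \<open>F_rel_ex1\<close> gives
  uniqueness.\<close>

lemma F_mor_eq:
  assumes "F_rel T F \<phi> c c' f h" "c \<in> E" "c' \<in> E"
  shows "Fm f = h"
  unfolding F_mor_def
proof (rule the_equality)
  show "\<exists>c c'. F_rel T F \<phi> c c' f h" using assms by blast
  fix h' assume "\<exists>c c'. F_rel T F \<phi> c c' f h'"
  then have "F_rel T F \<phi> c c' f h'"
    using assms(1) unfolding F_rel_def by (auto simp: hom_iff)
  then show "h' = h"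
    using F_rel_ex1[OF assms(2,3)] assms(1) unfolding F_rel_def by blast
qed

lemma G_mor_eq:
  assumes "G_rel T G \<psi> c c' f h" "c \<in> E" "c' \<in> E"
  shows "Gm f = h"
  unfolding G_mor_def
proof (rule the_equality)
  show "\<exists>c c'. G_rel T G \<psi> c c' f h" using assms by blast
  fix h' assume "\<exists>c c'. G_rel T G \<psi> c c' f h'"
  then have "G_rel T G \<psi> c c' f h'"
    using assms(1) unfolding G_rel_def by (auto simp: hom_iff)
  then show "h' = h"
    using G_rel_ex1[OF assms(2,3)] assms(1) unfolding G_rel_def by blast
qed

lemma
  assumes "arr f" "src f \<in> E" "tgt f \<in> E"
  shows Fm_arr [simp]: "arr (Fm f)" "src (Fm f) = F (src f)" "tgt (Fm f) = F (tgt f)"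
    and Fm_phi: "\<phi> (tgt f) \<cdot> SuspM T (Fm f) = f \<cdot> \<phi> (src f)"
    and Gm_arr [simp]: "arr (Gm f)" "src (Gm f) = G (src f)" "tgt (Gm f) = G (tgt f)"
    and Gm_psi: "Gm f \<cdot> \<psi> (src f) = \<psi> (tgt f) \<cdot> f"
proof -
  obtain h where h: "F_rel T F \<phi> (src f) (tgt f) f h"
    using F_rel_ex1[OF assms(2,3) arr_hom[OF assms(1)]] by blast
  then have "F_rel T F \<phi> (src f) (tgt f) f (Fm f)"
    using F_mor_eq[OF h assms(2,3)] by simp
  then show "arr (Fm f)" "src (Fm f) = F (src f)" "tgt (Fm f) = F (tgt f)"
     "\<phi> (tgt f) \<cdot> SuspM T (Fm f) = f \<cdot> \<phi> (src f)"
    by (auto simp: F_rel_def hom_iff)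
  obtain h where h: "G_rel T G \<psi> (src f) (tgt f) f h"
    using G_rel_ex1[OF assms(2,3) arr_hom[OF assms(1)]] by blast
  then have "G_rel T G \<psi> (src f) (tgt f) f (Gm f)"
    using G_mor_eq[OF h assms(2,3)] by simp
  then show "arr (Gm f)" "src (Gm f) = G (src f)" "tgt (Gm f) = G (tgt f)"
     "Gm f \<cdot> \<psi> (src f) = \<psi> (tgt f) \<cdot> f"
    by (auto simp: G_rel_def hom_iff)
qed

lemma Fm_cmp:
  assumes "arr f" "arr g" "tgt f = src g" "src f \<in> E" "src g \<in> E" "tgt g \<in> E"
  shows "Fm (g \<cdot> f) = Fm g \<cdot> Fm f"
proof (rule F_mor_eq)
  have "\<phi> (tgt g) \<cdot> (SuspM T (Fm g) \<cdot> SuspM T (Fm f)) = g \<cdot> (\<phi> (tgt f) \<cdot> SuspM T (Fm f))"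
    using reassoc[OF Fm_phi[of g], of "SuspM T (Fm f)"] assms by (simp add: assoc)
  also have "\<dots> = g \<cdot> (f \<cdot> \<phi> (src f))"
    using Fm_phi[of f] assms by simp
  finally show "F_rel T F \<phi> (src f) (tgt g) (g \<cdot> f) (Fm g \<cdot> Fm f)"
    unfolding F_rel_def using assms by (simp add: hom_iff SuspM_cmp assoc)
qed (use assms in auto)

lemma Gm_cmp:
  assumes "arr f" "arr g" "tgt f = src g" "src f \<in> E" "src g \<in> E" "tgt g \<in> E"
  shows "Gm (g \<cdot> f) = Gm g \<cdot> Gm f"
proof (rule G_mor_eq)
  have "Gm g \<cdot> (Gm f \<cdot> \<psi> (src f)) = Gm g \<cdot> (\<psi> (src g) \<cdot> f)"
    using Gm_psi[of f] assms by simp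
  also have "\<dots> = (\<psi> (tgt g) \<cdot> g) \<cdot> f"
    by (rule reassoc) (use Gm_psi[of g] assms in simp_all)
  finally show "G_rel T G \<psi> (src f) (tgt g) (g \<cdot> f) (Gm g \<cdot> Gm f)"
    unfolding G_rel_def using assms by (simp add: hom_iff assoc)
qed (use assms in auto)

lemma F_functor: "is_functor (full_sub T E) (full_sub T A) F Fm"
proof -
  have "Fm (Ident T x) = Ident T (F x)" if "x \<in> E" for x
    by (rule F_mor_eq[of x x]) (use that in \<open>auto simp: F_rel_def hom_iff\<close>)
  then show ?thesis
    unfolding is_functor_def using Fm_cmp by (auto simp: hom_full_sub_iff)
qed

lemma G_functor: "is_functor (full_sub T E) (full_sub T A) G Gm"
proof -
  have "Gm (Ident T x) = Ident T (G x)" if "x \<in> E" for x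
    by (rule G_mor_eq[of x x]) (use that in \<open>auto simp: G_rel_def hom_iff\<close>)
  then show ?thesis
    unfolding is_functor_def using Gm_cmp by (auto simp: hom_full_sub_iff)
qed

lemma Fm_Zero: "c \<in> E \<Longrightarrow> c' \<in> E \<Longrightarrow> Fm (Zero T c c') = Zero T (F c) (F c')"
  by (rule F_mor_eq[of c c']) (auto simp: F_rel_def hom_iff)

lemma Gm_Zero: "c \<in> E \<Longrightarrow> c' \<in> E \<Longrightarrow> Gm (Zero T c c') = Zero T (G c) (G c')"
  by (rule G_mor_eq[of c c']) (auto simp: G_rel_def hom_iff)

text \<open>The composite runs between suspensions, so fullness supplies
  \<open>\<delta>\<close>.\<close>

lemma connecting_hom_exists:
  assumes "arr h" "src h \<in> E" "tgt h = SuspO T c" "c \<in> E"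
  obtains \<delta> where "arr \<delta>" "src \<delta> = F (src h)" "tgt \<delta> = G c"
    "SuspM T \<delta> = SuspM T (\<psi> c) \<cdot> (h \<cdot> \<phi> (src h))"
proof (rule SuspM_full)
  let ?v = "SuspM T (\<psi> c) \<cdot> (h \<cdot> \<phi> (src h))"
  show "arr ?v" "src ?v = SuspO T (F (src h))" "tgt ?v = SuspO T (G c)"
    "F (src h) \<in> Ob T" "G c \<in> Ob T"
    using assms by simp_all
qed (use that in metis)

section \<open>A fixed triangle with vertices in \<open>E\<close>\<close>

context
  fixes f g h c c' c''
  assumes tri: "(f, g, h) \<in> Tri T"
    and c: "src f = c" "tgt f = c'" "tgt g = c''"
    and E: "c \<in> E" "c' \<in> E" "c'' \<in> E"
begin

lemma fgh: "arr f" "arr g" "arr h" "src g = c'" "src h = c''" "tgt h = SuspO T c"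
  using tri_arr[OF tri] c by simp_all

lemma Ff: "arr (Fm f)" "src (Fm f) = F c" "tgt (Fm f) = F c'" "\<phi> c' \<cdot> SuspM T (Fm f) = f \<cdot> \<phi> c"
  and Gf: "arr (Gm f)" "src (Gm f) = G c" "tgt (Gm f) = G c'" "Gm f \<cdot> \<psi> c = \<psi> c' \<cdot> f"
  using Fm_arr[OF fgh(1), unfolded c, OF E(1,2)] Fm_phi[OF fgh(1), unfolded c, OF E(1,2)]
    Gm_arr[OF fgh(1), unfolded c, OF E(1,2)] Gm_psi[OF fgh(1), unfolded c, OF E(1,2)] by blast+

lemma Fg: "arr (Fm g)" "src (Fm g) = F c'" "tgt (Fm g) = F c''" "\<phi> c'' \<cdot> SuspM T (Fm g) = g \<cdot> \<phi> c'"
  and Gg: "arr (Gm g)" "src (Gm g) = G c'" "tgt (Gm g) = G c''" "Gm g \<cdot> \<psi> c' = \<psi> c'' \<cdot> g"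
  using Fm_arr[OF fgh(2), unfolded c fgh, OF E(2,3)] Fm_phi[OF fgh(2), unfolded c fgh, OF E(2,3)]
    Gm_arr[OF fgh(2), unfolded c fgh, OF E(2,3)] Gm_psi[OF fgh(2), unfolded c fgh, OF E(2,3)] by blast+

lemma Fg_Ff: "Fm g \<cdot> Fm f = Zero T (F c) (F c'')"
  using Fm_cmp[of f g] Fm_Zero[of c c''] tri_comp_zero(1)[OF tri] fgh c E by simp

lemma Gg_Gf: "Gm g \<cdot> Gm f = Zero T (G c) (G c'')"
  using Gm_cmp[of f g] Gm_Zero[of c c''] tri_comp_zero(1)[OF tri] fgh c E by simp

text \<open>If \<open>Fm g\<close> kills \<open>v\<close>, then \<open>g\<close> kills
  \<open>\<phi> c' \<cdot> SuspM T v\<close>, which lifts along \<open>f\<close> and then along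
  \<open>\<phi> c\<close>. For injectivity, a map from \<Sigma>A to \<open>c\<close> killed by
  \<open>f\<close> becomes, after suspension, a composite of \<open>h\<close> with a map from
  \<Sigma>\<Sigma>A to \<open>c''\<close>, and the latter is zero.\<close>

lemma Fm_kernel: "is_kernel (full_sub T A) (Fm g) (Fm f)"
proof (rule full_kernelI)
  fix v assume v: "arr v" "src v \<in> A" "tgt v = src (Fm g)" "Fm g \<cdot> v = Zero T (src v) (tgt (Fm g))"
  have "g \<cdot> (\<phi> c' \<cdot> SuspM T v) = (\<phi> c'' \<cdot> SuspM T (Fm g)) \<cdot> SuspM T v"
    by (rule reassoc) (use Fg fgh c E v(1-3) in simp_all)
  also have "\<dots> = \<phi> c'' \<cdot> SuspM T (Fm g \<cdot> v)"
    using Fg(1-3) fgh c E v(1-3) by (simp add: assoc SuspM_cmp)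
  also have "\<dots> = Zero T (SuspO T (src v)) c''"
    using Fg(1-3) E v by simp
  finally obtain s where s: "arr s" "src s = SuspO T (src v)" "tgt s = c" "f \<cdot> s = \<phi> c' \<cdot> SuspM T v"
    using lift_mid[OF tri, of "\<phi> c' \<cdot> SuspM T v"] v(1-3) Fg(1-3) c E by auto
  obtain u where u: "arr u" "src u = src v" "tgt u = F c" "\<phi> c \<cdot> SuspM T u = s"
    using phi_lift[OF s(1,2)] s v(1-3) c E by auto
  have "\<phi> c' \<cdot> SuspM T (Fm f \<cdot> u) = \<phi> c' \<cdot> (SuspM T (Fm f) \<cdot> SuspM T u)"
    using Ff(1-3) u(1-3) by (simp add: SuspM_cmp)
  also have "\<dots> = (f \<cdot> \<phi> c) \<cdot> SuspM T u"
    by (rule reassoc) (use Ff u(1-3) E in simp_all)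
  also have "\<dots> = \<phi> c' \<cdot> SuspM T v"
    using u s(4) fgh c E by (simp add: assoc)
  finally have "Fm f \<cdot> u = v"
    by (rule phi_cancel[OF E(2), rotated -1]) (use v(1-3) u(1-3) Ff Fg(1-3) E in simp_all)
  then show "\<exists>t. arr t \<and> src t = src v \<and> tgt t = src (Fm f) \<and> Fm f \<cdot> t = v"
    using u Ff by auto
next
  fix t assume t: "arr t" "src t \<in> A" "tgt t = src (Fm f)" "Fm f \<cdot> t = Zero T (src t) (tgt (Fm f))"
  let ?s = "\<phi> c \<cdot> SuspM T t"
  have s: "arr ?s" "src ?s = SuspO T (src t)" "tgt ?s = c"
    using t(1-3) Ff E by simp_all
  have "f \<cdot> ?s = (\<phi> c' \<cdot> SuspM T (Fm f)) \<cdot> SuspM T t"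
    by (rule reassoc) (use Ff fgh c E t(1-3) in simp_all)
  also have "\<dots> = \<phi> c' \<cdot> SuspM T (Fm f \<cdot> t)"
    using Ff(1-3) fgh c E t(1-3) by (simp add: assoc SuspM_cmp)
  also have "\<dots> = Zero T (SuspO T (src t)) c'"
    using Ff(1-3) E t by simp
  finally have fs: "f \<cdot> ?s = Zero T (SuspO T (src t)) c'" .
  have "SuspM T f \<cdot> SuspM T ?s = SuspM T (f \<cdot> ?s)"
    by (rule SuspM_cmp[symmetric]) (use s fgh c in simp_all)
  also have "\<dots> = Zero T (SuspO T (SuspO T (src t))) (SuspO T c')"
    unfolding fs using t E by simp
  finally obtain r where r: "arr r" "src r = SuspO T (SuspO T (src t))" "tgt r = c''" "h \<cdot> r = SuspM T ?s"
    using lift_susp[OF tri, of "SuspM T ?s"] s c by auto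
  have "r = Zero T (SuspO T (SuspO T (src t))) c''"
    using vanish_SSA_E[OF r(1,2)] r t E by simp
  then have "SuspM T ?s = Zero T (SuspO T (SuspO T (src t))) (SuspO T c)"
    using r fgh t by simp
  then have "?s = Zero T (SuspO T (src t)) c"
    using SuspM_zeroD[OF s(1)] s by simp
  then show "t = Zero T (src t) (src (Fm f))"
    using phi_mono[OF E(1) t(1,2)] t(3) Ff by simp
qed (use Ff Fg Fg_Ff E in simp_all)

text \<open>Dual to \<open>Fm_kernel\<close>. A map from \<open>c''\<close> to A that vanishes on
  \<open>g\<close> factors through \<open>h\<close> by a map from \<Sigma>c to A, which is zero by
  \<open>vanish_SE_A\<close>.\<close>

lemma Gm_cokernel: "is_cokernel (full_sub T A) (Gm f) (Gm g)"
proof (rule full_cokernelI)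
  fix v assume v: "arr v" "tgt v \<in> A" "src v = tgt (Gm f)" "v \<cdot> Gm f = Zero T (src (Gm f)) (tgt v)"
  have "(v \<cdot> \<psi> c') \<cdot> f = v \<cdot> (Gm f \<cdot> \<psi> c)"
    using Gf fgh c E v(1-3) by (simp add: assoc)
  also have "\<dots> = Zero T c (tgt v)"
    by (subst reassoc[OF v(4)]) (use Gf E v(1-3) in simp_all)
  finally obtain s where s: "arr s" "src s = c''" "tgt s = tgt v" "s \<cdot> g = v \<cdot> \<psi> c'"
    using extend_mid[OF tri, of "v \<cdot> \<psi> c'"] v(1-3) Gf(1-3) c E by auto
  obtain u where u: "arr u" "src u = G c''" "tgt u = tgt v" "u \<cdot> \<psi> c'' = s"
    using psi_extend[OF s(1)] s v(1-3) c E by auto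
  have "(u \<cdot> Gm g) \<cdot> \<psi> c' = u \<cdot> (\<psi> c'' \<cdot> g)"
    using u(1-3) Gg E by (simp add: assoc)
  also have "\<dots> = v \<cdot> \<psi> c'"
    by (subst reassoc[OF u(4)]) (use u(1-3) s fgh c E in simp_all)
  finally have "u \<cdot> Gm g = v"
    by (rule psi_cancel[OF E(2), rotated -1]) (use v(1-3) u(1-3) Gg Gf(1-3) E in simp_all)
  then show "\<exists>t. arr t \<and> src t = tgt (Gm g) \<and> tgt t = tgt v \<and> t \<cdot> Gm g = v"
    using u Gg by auto
next
  fix t assume t: "arr t" "tgt t \<in> A" "src t = tgt (Gm g)" "t \<cdot> Gm g = Zero T (src (Gm g)) (tgt t)"
  let ?s = "t \<cdot> \<psi> c''"
  have s: "arr ?s" "src ?s = c''" "tgt ?s = tgt t"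
    using t(1-3) Gg E by simp_all
  have "?s \<cdot> g = t \<cdot> (Gm g \<cdot> \<psi> c')"
    using Gg fgh c E t(1-3) by (simp add: assoc)
  also have "\<dots> = Zero T c' (tgt t)"
    by (subst reassoc[OF t(4)]) (use Gg E t(1-3) in simp_all)
  finally obtain r where r: "arr r" "src r = SuspO T c" "tgt r = tgt t" "r \<cdot> h = ?s"
    using extend_end[OF tri, of ?s] s c fgh by auto
  have "r = Zero T (SuspO T c) (tgt t)"
    using vanish_SE_A[OF r(1,2)] r t E by simp
  then have "?s = Zero T c'' (tgt t)"
    using r fgh t by simp
  then show "t = Zero T (tgt (Gm g)) (tgt t)"
    using psi_epi[OF E(3) t(1) _ t(2)] t(3) Gg by simp
qed (use Gf Gg Gg_Gf E in simp_all)

section \<open>Exactness on both sides of the connecting morphism\<close>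

context
  fixes \<delta>
  assumes \<delta>: "arr \<delta>" "src \<delta> = F c''" "tgt \<delta> = G c"
    "SuspM T \<delta> = SuspM T (\<psi> c) \<cdot> (h \<cdot> \<phi> c'')"
begin

text \<open>After suspension, this composite and the one in \<open>Gf_delta\<close> contain
  consecutive maps of the given triangle, namely \<open>h \<cdot> g\<close> and
  \<open>SuspM T f \<cdot> h\<close>.\<close>

lemma delta_Fg: "\<delta> \<cdot> Fm g = Zero T (F c') (G c)"
proof (rule SuspM_faithful)
  have "SuspM T (\<delta> \<cdot> Fm g) = SuspM T (\<psi> c) \<cdot> (h \<cdot> (\<phi> c'' \<cdot> SuspM T (Fm g)))"
    using \<delta> Fg(1-3) fgh E by (simp add: SuspM_cmp assoc)
  also have "\<dots> = SuspM T (\<psi> c) \<cdot> (h \<cdot> (g \<cdot> \<phi> c'))"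
    unfolding Fg(4) ..
  also have "h \<cdot> (g \<cdot> \<phi> c') = Zero T c' (SuspO T c) \<cdot> \<phi> c'"
    by (rule reassoc) (use tri_comp_zero(2)[OF tri] fgh c E in simp_all)
  finally show "SuspM T (\<delta> \<cdot> Fm g) = SuspM T (Zero T (F c') (G c))"
    using E by simp
qed (use \<delta> Fg E in simp_all)

lemma Gf_delta: "Gm f \<cdot> \<delta> = Zero T (F c'') (G c')"
proof (rule SuspM_faithful)
  have e: "SuspM T (Gm f) \<cdot> SuspM T (\<psi> c) = SuspM T (\<psi> c') \<cdot> SuspM T f"
    using SuspM_cmp[of "\<psi> c" "Gm f"] SuspM_cmp[of f "\<psi> c'"] Gf fgh c E by simp
  have "SuspM T (Gm f \<cdot> \<delta>) = SuspM T (Gm f) \<cdot> (SuspM T (\<psi> c) \<cdot> (h \<cdot> \<phi> c''))"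
    using \<delta> Gf(1-3) by (simp add: SuspM_cmp)
  also have "\<dots> = (SuspM T (\<psi> c') \<cdot> SuspM T f) \<cdot> (h \<cdot> \<phi> c'')"
    by (rule reassoc[OF e]) (use Gf(1-3) fgh E in simp_all)
  also have "\<dots> = SuspM T (\<psi> c') \<cdot> (SuspM T f \<cdot> (h \<cdot> \<phi> c''))"
    using Gf(1-3) fgh E c by (simp add: assoc)
  also have "SuspM T f \<cdot> (h \<cdot> \<phi> c'') = Zero T c'' (SuspO T c') \<cdot> \<phi> c''"
    by (rule reassoc) (use tri_comp_zero(3)[OF tri] fgh c E in simp_all)
  finally show "SuspM T (Gm f \<cdot> \<delta>) = SuspM T (Zero T (F c'') (G c'))"
    using E by simp
qed (use \<delta> Gf E in simp_all)

text \<open>Let \<open>i\<close> be the map induced by \<open>Fm g\<close> on the cokernel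
  \<open>q\<close> of \<open>Fm f\<close>. The vanishing of \<open>\<delta> \<cdot> x\<close> yields
  a map \<open>x'\<close> such that \<open>x\<close> plus \<open>i \<cdot> x'\<close> factors
  through \<open>Fm g\<close>. Now \<open>p\<close> kills this sum, and it kills \<open>i\<close>
  because \<open>q\<close> is epi, so it kills \<open>x\<close>.\<close>

lemma delta_zero_factors:
  assumes p: "is_cokernel (full_sub T A) (Fm g) p"
    and x: "arr x" "src x \<in> A" "tgt x = F c''" "\<delta> \<cdot> x = Zero T (src x) (G c)"
  shows "p \<cdot> x = Zero T (src x) (tgt p)"
proof -
  note P = full_cokernelD(2,5-7)[OF p]
  have P': "src p = F c''" "p \<cdot> Fm g = Zero T (F c') (tgt p)"
    using P Fg by simp_all
  obtain q where q: "is_cokernel (full_sub T A) (Fm f) q"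
    using full_cokernel_exists[of "Fm f"] Ff E by auto
  note Q = full_cokernelD[OF q]
  have Q': "arr q" "src q = F c'" "tgt q \<in> A"
    using Q(2,5,6) Ff by simp_all
  obtain i where i: "arr i" "src i = tgt q" "tgt i = F c''" "i \<cdot> q = Fm g"
    using Q(8)[of "Fm g"] Fg Ff Fg_Ff E by auto
  have "(p \<cdot> i) \<cdot> q = Zero T (src q) (tgt (p \<cdot> i))"
    using P P' i Q' by (simp add: assoc)
  then have pi: "p \<cdot> i = Zero T (tgt q) (tgt p)"
    using Q(9)[of "p \<cdot> i"] P P' i by simp
  obtain d where d: "(Fm f, q, d) \<in> Tri T"
    using short_exact_tri[OF full_exact(3)[OF Fm_kernel q] q] by blast
  have D: "arr d" "src d = tgt q" "tgt d = SuspO T (F c)"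
    using tri_arr[OF d] Ff by simp_all
  \<comment> \<open>Rotating three times suspends the triangle at the cost of a sign on each map; the fill-in
    is forced to be \<open>\<phi> c'' \<cdot> \<Sigma>i\<close> up to sign.\<close>
  obtain w where w: "arr w" "src w = SuspO T (tgt q)" "tgt w = c''"
     "w \<cdot> neg (SuspM T q) = g \<cdot> neg (\<phi> c')" "SuspM T (\<phi> c) \<cdot> neg (SuspM T d) = h \<cdot> w"
  proof (rule fill[OF rotate[OF rotate[OF rotate[OF d]]] tri, of "\<phi> c" "neg (\<phi> c')"])
    show "neg (\<phi> c') \<cdot> neg (SuspM T (Fm f)) = f \<cdot> \<phi> c"
      using Ff fgh c E by (simp add: cmp_neg)
  qed (use Ff Q' c E that in simp_all)
  have "neg (w \<cdot> SuspM T q) = neg (g \<cdot> \<phi> c')"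
    using w(1-4) Q' fgh E by (simp add: cmp_neg)
  then have wq: "w \<cdot> SuspM T q = g \<cdot> \<phi> c'"
    by (rule neg_inject) (use w(1-3) Q' fgh E in simp_all)
  let ?w = "\<phi> c'' \<cdot> SuspM T i"
  have w': "arr ?w" "src ?w = SuspO T (tgt q)" "tgt ?w = c''"
    using i E by simp_all
  have w'q: "?w \<cdot> SuspM T q = g \<cdot> \<phi> c'"
    using SuspM_cmp[of q i] i Q' E Fg(4) by (simp add: assoc)
  \<comment> \<open>The difference \<open>e\<close> vanishes on \<open>SuspM T q\<close>, so it
    factors through \<open>SuspM T d\<close> by a map from \<Sigma>\<Sigma>A to \<open>c''\<close>,
    which is zero.\<close>
  obtain e where e: "arr e" "src e = SuspO T (tgt q)" "tgt e = c''" "w = Plus T ?w e"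
    using difference[of w ?w] w(1-3) w' by metis
  have "w \<cdot> SuspM T q = Plus T (?w \<cdot> SuspM T q) (e \<cdot> SuspM T q)"
    unfolding e(4) by (rule cmp_plus) (use e(1-3) w' Q' in simp_all)
  then have "Plus T (g \<cdot> \<phi> c') (e \<cdot> SuspM T q) = g \<cdot> \<phi> c'"
    unfolding wq w'q by (rule sym)
  then have "e \<cdot> SuspM T q = Zero T (SuspO T (F c')) c''"
    by (rule plus_cancelD) (use e(1-3) fgh Q' E c in simp_all)
  then obtain r where r: "arr r" "src r = SuspO T (SuspO T (F c))" "tgt r = c''" "r \<cdot> SuspM T d = e"
    using extend_susp_end[OF d, of e] e(1-3) Ff by auto
  have "r = Zero T (SuspO T (SuspO T (F c))) c''"
    using vanish_SSA_E[OF r(1,2)] r E by simp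
  then have "e = Zero T (SuspO T (tgt q)) c''"
    using r(4) D E by auto
  then have ww: "w = ?w"
    unfolding e(4) by (intro plus_zero) (use w' E Q' in simp_all)
  have hw: "h \<cdot> ?w = neg (SuspM T (\<phi> c) \<cdot> SuspM T d)"
    using w(5) D E unfolding ww by (simp add: cmp_neg)

  \<comment> \<open>The obstruction to lifting \<open>\<phi> c'' \<cdot> SuspM T x\<close> along
    \<open>g\<close>. Followed by \<open>SuspM T (\<psi> c)\<close> it becomes the suspension of
    \<open>\<delta> \<cdot> x\<close>, so it comes from \<Sigma>\<Sigma>(F c) by a map
    \<open>z\<close>.\<close>
  let ?y = "h \<cdot> (\<phi> c'' \<cdot> SuspM T x)"
  have y: "arr ?y" "src ?y = SuspO T (src x)" "tgt ?y = SuspO T c"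
    using fgh x E by simp_all
  have "SuspM T (\<psi> c) \<cdot> ?y = SuspM T (\<delta> \<cdot> x)"
    using \<delta> x(1-3) fgh E by (simp add: SuspM_cmp assoc)
  then have "SuspM T (\<psi> c) \<cdot> ?y = Zero T (SuspO T (src x)) (SuspO T (G c))"
    unfolding x(4) using x E by simp
  moreover obtain \<chi> where \<chi>: "(\<phi> c, \<psi> c, \<chi>) \<in> Tri T"
    using approx_extension_tri[OF E(1)] by blast
  ultimately obtain z where z: "arr z" "src z = SuspO T (src x)" "tgt z = SuspO T (SuspO T (F c))"
      "SuspM T (\<phi> c) \<cdot> z = ?y"
    using lift_susp_mid[OF \<chi>, of ?y] y E by auto
  \<comment> \<open>This must vanish for the desuspension of \<open>z\<close> to lift along
    \<open>d\<close>. It is killed by \<open>SuspM T (\<phi> c')\<close>, because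
    \<open>SuspM T f\<close> kills \<open>?y\<close>; hence it factors through \<open>G c'\<close>
    by a map from \<Sigma>A to A.\<close>
  let ?z = "SuspM T (SuspM T (Fm f)) \<cdot> z"
  have z': "arr ?z" "src ?z = SuspO T (src x)" "tgt ?z = SuspO T (SuspO T (F c'))"
    using z Ff by simp_all
  have e1: "SuspM T (\<phi> c') \<cdot> SuspM T (SuspM T (Fm f)) = SuspM T f \<cdot> SuspM T (\<phi> c)"
    using SuspM_cmp[of "SuspM T (Fm f)" "\<phi> c'"] SuspM_cmp[of "\<phi> c" f] Ff fgh c E by simp
  have "SuspM T (\<phi> c') \<cdot> ?z = (SuspM T f \<cdot> SuspM T (\<phi> c)) \<cdot> z"
    by (rule reassoc[OF e1]) (use z Ff E in simp_all)
  also have "\<dots> = SuspM T f \<cdot> ?y"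
    using z fgh c E by (simp add: assoc)
  also have "\<dots> = Zero T c'' (SuspO T c') \<cdot> (\<phi> c'' \<cdot> SuspM T x)"
    by (rule reassoc) (use tri_comp_zero(3)[OF tri] fgh x c E in simp_all)
  also have "\<dots> = Zero T (SuspO T (src x)) (SuspO T c')"
    using x E by simp
  finally have *: "SuspM T (\<phi> c') \<cdot> ?z = Zero T (SuspO T (src x)) (SuspO T c')" .
  obtain \<chi>' where \<chi>': "(\<phi> c', \<psi> c', \<chi>') \<in> Tri T" "arr \<chi>'" "src \<chi>' = G c'" "tgt \<chi>' = SuspO T (SuspO T (F c'))"
    using approx_extension_tri[OF E(2)] by blast
  obtain s where s: "arr s" "src s = SuspO T (src x)" "tgt s = G c'" "\<chi>' \<cdot> s = ?z"
    using lift_susp[OF \<chi>'(1) z'(1)] z' * E by auto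
  have "s = Zero T (SuspO T (src x)) (G c')"
    using s x E by (intro vanish_SA_A) auto
  then have z0: "?z = Zero T (SuspO T (src x)) (SuspO T (SuspO T (F c')))"
    using s \<chi>' x by auto
  obtain z1 where z1: "arr z1" "src z1 = src x" "tgt z1 = SuspO T (F c)" "z = SuspM T z1"
    using SuspM_full[OF z(1-3)] x E by auto
  have "SuspM T (Fm f) \<cdot> z1 = Zero T (src x) (SuspO T (F c'))"
  proof (rule SuspM_faithful)
    have "SuspM T (SuspM T (Fm f) \<cdot> z1) = ?z"
      using z1 Ff by (simp add: SuspM_cmp)
    also note z0
    finally show "SuspM T (SuspM T (Fm f) \<cdot> z1) = SuspM T (Zero T (src x) (SuspO T (F c')))"
      using x E by simp
  qed (use z1 Ff x E in simp_all)
  then obtain x' where x': "arr x'" "src x' = src x" "tgt x' = tgt q" "d \<cdot> x' = z1"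
    using lift_susp[OF d z1(1)] z1 Ff by auto
  \<comment> \<open>The sign from the triple rotation makes the obstruction of
    \<open>i \<cdot> x'\<close> equal to minus \<open>?y\<close>. The correction is therefore added,
    and \<open>?u\<close> has no obstruction.\<close>
  let ?u = "Plus T x (i \<cdot> x')"
  have ix: "arr (i \<cdot> x')" "src (i \<cdot> x') = src x" "tgt (i \<cdot> x') = F c''"
    using i x' by simp_all
  have u: "arr ?u" "src ?u = src x" "tgt ?u = F c''"
    using ix x by simp_all
  have y1: "?y = SuspM T (\<phi> c) \<cdot> (SuspM T d \<cdot> SuspM T x')"
    unfolding z(4)[symmetric] z1(4) x'(4)[symmetric] by (subst SuspM_cmp) (use x' D in simp_all)
  have "h \<cdot> (\<phi> c'' \<cdot> SuspM T (i \<cdot> x')) = h \<cdot> (?w \<cdot> SuspM T x')"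
    using i(1-3) x'(1-3) E by (simp add: SuspM_cmp assoc)
  also have "\<dots> = neg (SuspM T (\<phi> c) \<cdot> SuspM T d) \<cdot> SuspM T x'"
    by (rule reassoc[OF hw]) (use w' x' fgh in simp_all)
  also have "\<dots> = neg ?y"
    unfolding y1 using x' D E by (simp add: cmp_neg assoc)
  finally have hi: "h \<cdot> (\<phi> c'' \<cdot> SuspM T (i \<cdot> x')) = neg ?y" .
  have "SuspM T ?u = Plus T (SuspM T x) (SuspM T (i \<cdot> x'))"
    by (rule susp_plus) (use ix x in \<open>simp_all add: hom_iff\<close>)
  then have "\<phi> c'' \<cdot> SuspM T ?u = Plus T (\<phi> c'' \<cdot> SuspM T x) (\<phi> c'' \<cdot> SuspM T (i \<cdot> x'))"
    by (simp only:) (rule cmp_plus, use ix x E in simp_all)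
  then have "h \<cdot> (\<phi> c'' \<cdot> SuspM T ?u) = Plus T ?y (h \<cdot> (\<phi> c'' \<cdot> SuspM T (i \<cdot> x')))"
    by (simp only:) (rule cmp_plus, use ix x fgh E in simp_all)
  also have "\<dots> = Zero T (SuspO T (src x)) (SuspO T c)"
    unfolding hi using plus_neg[OF y(1)] y by simp
  finally obtain s' where s': "arr s'" "src s' = SuspO T (src x)" "tgt s' = c'" "g \<cdot> s' = \<phi> c'' \<cdot> SuspM T ?u"
    using lift_end[OF tri, of "\<phi> c'' \<cdot> SuspM T ?u"] u fgh c E by auto
  obtain v where v: "arr v" "src v = src x" "tgt v = F c'" "\<phi> c' \<cdot> SuspM T v = s'"
    using phi_lift[OF s'(1,2)] s' x E by auto
  have "\<phi> c'' \<cdot> SuspM T (Fm g \<cdot> v) = (g \<cdot> \<phi> c') \<cdot> SuspM T v"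
    using reassoc[OF Fg(4), of "SuspM T v"] v(1-3) Fg(1-3) E by (simp add: SuspM_cmp)
  also have "\<dots> = \<phi> c'' \<cdot> SuspM T ?u"
    unfolding s'(4)[symmetric] v(4)[symmetric] by (rule assoc) (use v(1-3) fgh E in simp_all)
  finally have Fgv: "Fm g \<cdot> v = ?u"
    by (rule phi_cancel[OF E(3), rotated -1]) (use v(1-3) Fg(1-3) u x(2) in simp_all)
  have "p \<cdot> ?u = (p \<cdot> Fm g) \<cdot> v"
    unfolding Fgv[symmetric] by (rule assoc[symmetric]) (use v P P' Fg in simp_all)
  also have "\<dots> = Zero T (src x) (tgt p)"
    unfolding P'(2) using v P by simp
  also have "p \<cdot> ?u = Plus T (p \<cdot> x) (p \<cdot> (i \<cdot> x'))"
    by (rule cmp_plus) (use ix x P P' in simp_all)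
  also have "p \<cdot> (i \<cdot> x') = Zero T (src x) (tgt p)"
    using reassoc[OF pi, of x'] i x' P P' Q' by simp
  also have "Plus T (p \<cdot> x) (Zero T (src x) (tgt p)) = p \<cdot> x"
    by (rule plus_zero) (use x P P' in simp_all)
  finally show ?thesis .
qed

text \<open>The image \<open>k\<close> of \<open>Fm g\<close> is the kernel of its cokernel
  \<open>p\<close>. It is killed by \<open>\<delta>\<close>, which factors through \<open>p\<close>;
  conversely, \<open>delta_zero_factors\<close> shows that \<open>p\<close> kills everything that
  \<open>\<delta>\<close> kills.\<close>

lemma exact_at_delta_left: "exact_at (full_sub T A) (Fm g) \<delta>"
proof -
  obtain p where p: "is_cokernel (full_sub T A) (Fm g) p"
    using full_cokernel_exists[of "Fm g"] Fg E by auto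
  note P = full_cokernelD[OF p]
  have P': "arr p" "src p = F c''" "tgt p \<in> A"
    using P(2,5,6) Fg by simp_all
  obtain k where k: "is_kernel (full_sub T A) p k"
    using full_kernel_exists[of p] P' E by auto
  note K = full_kernelD[OF k]
  have K': "arr k" "src k \<in> A" "tgt k = F c''" "p \<cdot> k = Zero T (src k) (tgt p)"
    using K(2,5-7) P' by simp_all
  have "is_kernel (full_sub T A) \<delta> k"
  proof (rule full_kernelI)
    obtain t where t: "arr t" "src t = tgt p" "tgt t = G c" "t \<cdot> p = \<delta>"
      using P(8)[of \<delta>] \<delta> Fg E delta_Fg by auto
    have "\<delta> \<cdot> k = t \<cdot> (p \<cdot> k)"
      by (rule reassoc[OF t(4), symmetric]) (use t K' P' in simp_all)
    then show "\<delta> \<cdot> k = Zero T (src k) (tgt \<delta>)"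
      using K' t \<delta> by simp
    show "\<exists>t. arr t \<and> src t = src v \<and> tgt t = src k \<and> k \<cdot> t = v"
      if "arr v" "src v \<in> A" "tgt v = src \<delta>" "\<delta> \<cdot> v = Zero T (src v) (tgt \<delta>)" for v
      using K(8)[of v] delta_zero_factors[OF p, of v] that \<delta> P' by simp
  qed (use K(9) K' \<delta> E in simp_all)
  moreover have "Fm g \<in> Hom (full_sub T A) (F c') (F c'')" "\<delta> \<in> Hom (full_sub T A) (F c'') (G c)"
    using Fg \<delta> E by (simp_all add: hom_full_sub_iff)
  ultimately show ?thesis
    unfolding exact_at_def is_image_def using p k by blast
qed

text \<open>Let \<open>j\<close> be \<open>Gm f\<close> viewed as a map into the kernel
  \<open>m\<close> of \<open>Gm g\<close>. The vanishing of \<open>y \<cdot> \<delta>\<close> splits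
  \<open>y\<close> as \<open>y1 \<cdot> j\<close> plus \<open>t \<cdot> Gm f\<close>. Both summands
  kill \<open>x\<close>, the first because \<open>m\<close> is mono and \<open>m \<cdot> j\<close>
  is \<open>Gm f\<close>.\<close>

lemma factors_of_zero_delta:
  assumes y: "arr y" "tgt y \<in> A" "src y = G c" "y \<cdot> \<delta> = Zero T (F c'') (tgt y)"
    and x: "arr x" "src x \<in> A" "tgt x = G c" "Gm f \<cdot> x = Zero T (src x) (G c')"
  shows "y \<cdot> x = Zero T (src x) (tgt y)"
proof -
  obtain m where m: "is_kernel (full_sub T A) (Gm g) m"
    using full_kernel_exists[of "Gm g"] Gg E by auto
  note M = full_kernelD[OF m]
  have M': "arr m" "src m \<in> A" "tgt m = G c'"
    using M(2,5,6) Gg by simp_all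
  obtain j where j: "arr j" "src j = G c" "tgt j = src m" "m \<cdot> j = Gm f"
    using M(8)[of "Gm f"] Gf Gg Gg_Gf E by auto
  have "m \<cdot> (j \<cdot> x) = Zero T (src x) (G c')"
    using reassoc[OF j(4), of x] x j M' by simp
  then have jx: "j \<cdot> x = Zero T (src x) (src m)"
    using M(9)[of "j \<cdot> x"] M' j x(1-3) by simp
  obtain d where d: "(m, Gm g, d) \<in> Tri T"
    using short_exact_tri[OF m full_exact(4)[OF Gm_cokernel m]] by blast
  have D: "arr d" "src d = G c''" "tgt d = SuspO T (src m)"
    using tri_arr[OF d] Gg by simp_all
  \<comment> \<open>This fill-in turns out to be the suspension of
    \<open>j \<cdot> \<psi> c\<close>: both have the same composite with \<open>SuspM T m\<close>,
    so their difference factors through \<open>d\<close> by a map from \<Sigma>c to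
    \<open>G c''\<close>, which is zero.\<close>
  obtain w where w: "arr w" "src w = SuspO T c" "tgt w = SuspO T (src m)"
     "w \<cdot> h = d \<cdot> \<psi> c''" "SuspM T (\<psi> c') \<cdot> neg (SuspM T f) = neg (SuspM T m) \<cdot> w"
    by (rule fill[OF rotate[OF tri] rotate[OF d], of "\<psi> c'" "\<psi> c''"])
      (use Gg fgh c D E that in simp_all)
  have "neg (SuspM T m \<cdot> w) = neg (SuspM T (\<psi> c') \<cdot> SuspM T f)"
    using w(1-3) w(5)[symmetric] M' fgh c E by (simp add: cmp_neg)
  then have mw: "SuspM T m \<cdot> w = SuspM T (\<psi> c') \<cdot> SuspM T f"
    by (rule neg_inject) (use w(1-3) M' fgh c E in simp_all)
  let ?w = "SuspM T (j \<cdot> \<psi> c)"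
  have w': "arr ?w" "src ?w = SuspO T c" "tgt ?w = SuspO T (src m)"
    using j E by simp_all
  have "SuspM T m \<cdot> ?w = SuspM T (m \<cdot> (j \<cdot> \<psi> c))"
    by (rule SuspM_cmp[symmetric]) (use j M' E in simp_all)
  also have "m \<cdot> (j \<cdot> \<psi> c) = Gm f \<cdot> \<psi> c"
    by (rule reassoc[OF j(4)]) (use j M' E in simp_all)
  also have "\<dots> = \<psi> c' \<cdot> f"
    by (rule Gf(4))
  also have "SuspM T (\<psi> c' \<cdot> f) = SuspM T (\<psi> c') \<cdot> SuspM T f"
    by (rule SuspM_cmp) (use fgh c E in simp_all)
  finally have mw': "SuspM T m \<cdot> ?w = SuspM T (\<psi> c') \<cdot> SuspM T f" .
  obtain e where e: "arr e" "src e = SuspO T c" "tgt e = SuspO T (src m)" "w = Plus T ?w e"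
    using difference[of w ?w] w(1-3) w' by metis
  have "SuspM T m \<cdot> w = Plus T (SuspM T m \<cdot> ?w) (SuspM T m \<cdot> e)"
    unfolding e(4) by (rule cmp_plus) (use e(1-3) w' M' in simp_all)
  then have "Plus T (SuspM T (\<psi> c') \<cdot> SuspM T f) (SuspM T m \<cdot> e) = SuspM T (\<psi> c') \<cdot> SuspM T f"
    unfolding mw mw' by (rule sym)
  then have "SuspM T m \<cdot> e = Zero T (SuspO T c) (SuspO T (G c'))"
    by (rule plus_cancelD) (use e(1-3) fgh M' E c in simp_all)
  then obtain r where r: "arr r" "src r = SuspO T c" "tgt r = G c''" "d \<cdot> r = e"
    using lift_susp[OF d e(1)] e(2,3) M' Gg by auto
  have "r = Zero T (SuspO T c) (G c'')"
    using vanish_SE_A[OF r(1,2)] r E by simp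
  then have "e = Zero T (SuspO T c) (SuspO T (src m))"
    using r(4) D E by auto
  then have ww: "w = ?w"
    unfolding e(4) by (intro plus_zero) (use w' M' E in simp_all)

  \<comment> \<open>Preceded by \<open>\<phi> c''\<close> this is the suspension of
    \<open>y \<cdot> \<delta>\<close>, hence zero, so \<open>?y\<close> factors through
    \<open>\<psi> c''\<close> by a map \<open>z\<close>.\<close>
  let ?y = "SuspM T (y \<cdot> \<psi> c) \<cdot> h"
  have y': "arr ?y" "src ?y = c''" "tgt ?y = SuspO T (tgt y)"
    using y fgh E by simp_all
  have "?y \<cdot> \<phi> c'' = SuspM T (y \<cdot> \<delta>)"
    using \<delta> y(1-3) fgh E by (simp add: SuspM_cmp assoc)
  then have "?y \<cdot> \<phi> c'' = Zero T (SuspO T (F c'')) (SuspO T (tgt y))"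
    unfolding y(4) using y E by simp
  moreover obtain \<chi> where \<chi>: "(\<phi> c'', \<psi> c'', \<chi>) \<in> Tri T"
    using approx_extension_tri[OF E(3)] by blast
  ultimately obtain z where z: "arr z" "src z = G c''" "tgt z = SuspO T (tgt y)" "z \<cdot> \<psi> c'' = ?y"
    using extend_mid[OF \<chi> y'(1)] y' E by auto
  \<comment> \<open>This must vanish for \<open>z\<close> to factor through \<open>d\<close>.
    Preceded by \<open>\<psi> c'\<close> it contains \<open>h \<cdot> g\<close>, so it factors
    through \<open>\<chi>'\<close> by a map from \<Sigma>\<Sigma>A to \<Sigma>A.\<close>
  let ?z = "z \<cdot> Gm g"
  have z': "arr ?z" "src ?z = G c'" "tgt ?z = SuspO T (tgt y)"
    using z Gg by simp_all
  have "?z \<cdot> \<psi> c' = z \<cdot> (\<psi> c'' \<cdot> g)"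
    using z(1-3) Gg E by (simp add: assoc)
  also have "\<dots> = ?y \<cdot> g"
    by (rule reassoc[OF z(4)]) (use z fgh c E in simp_all)
  also have "\<dots> = SuspM T (y \<cdot> \<psi> c) \<cdot> (h \<cdot> g)"
    by (rule assoc) (use y fgh c E in simp_all)
  also have "\<dots> = Zero T c' (SuspO T (tgt y))"
    using tri_comp_zero(2)[OF tri] y fgh c E by simp
  finally have *: "?z \<cdot> \<psi> c' = Zero T c' (SuspO T (tgt y))" .
  obtain \<chi>' where \<chi>': "(\<phi> c', \<psi> c', \<chi>') \<in> Tri T" "arr \<chi>'" "src \<chi>' = G c'" "tgt \<chi>' = SuspO T (SuspO T (F c'))"
    using approx_extension_tri[OF E(2)] by blast
  obtain s where s: "arr s" "src s = SuspO T (SuspO T (F c'))" "tgt s = SuspO T (tgt y)" "s \<cdot> \<chi>' = ?z"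
    using extend_end[OF \<chi>'(1) z'(1)] z' * E by auto
  have "s = Zero T (SuspO T (SuspO T (F c'))) (SuspO T (tgt y))"
    using s y E by (intro vanish_SSA_SA) auto
  then have "?z = Zero T (G c') (SuspO T (tgt y))"
    using s \<chi>' y by auto
  then obtain v where v: "arr v" "src v = SuspO T (src m)" "tgt v = SuspO T (tgt y)" "v \<cdot> d = z"
    using extend_end[OF d z(1)] z Gg by auto
  obtain y1 where y1: "arr y1" "src y1 = src m" "tgt y1 = tgt y" "v = SuspM T y1"
    using SuspM_full[OF v(1-3)] y M' by auto
  let ?j = "y1 \<cdot> j"
  have yj: "arr ?j" "src ?j = G c" "tgt ?j = tgt y"
    using y1 j by simp_all
  \<comment> \<open>By the choice of \<open>y1\<close>, the maps \<open>y\<close> and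
    \<open>?j\<close> give the same composite \<open>?y\<close>. For the remainder \<open>a\<close>,
    the suspension of \<open>a \<cdot> \<psi> c\<close> thus vanishes on \<open>h\<close>, so
    \<open>a \<cdot> \<psi> c\<close> extends over \<open>f\<close>, and the extension passes
    through \<open>\<psi> c'\<close>.\<close>
  obtain a where a: "arr a" "src a = G c" "tgt a = tgt y" "y = Plus T ?j a"
    using difference[of y ?j] y(1-3) yj by metis
  have "?y = SuspM T y1 \<cdot> (d \<cdot> \<psi> c'')"
    unfolding z(4)[symmetric] v(4)[symmetric] y1(4)[symmetric]
    by (rule assoc) (use v D E in simp_all)
  also have "\<dots> = (SuspM T y1 \<cdot> w) \<cdot> h"
    unfolding w(4)[symmetric] by (rule assoc[symmetric]) (use w y1 fgh in simp_all)
  also have "SuspM T y1 \<cdot> w = SuspM T (?j \<cdot> \<psi> c)"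
    unfolding ww using y1 j E by (simp add: SuspM_cmp assoc)
  finally have yh: "?y = SuspM T (?j \<cdot> \<psi> c) \<cdot> h" .
  have "y \<cdot> \<psi> c = Plus T (?j \<cdot> \<psi> c) (a \<cdot> \<psi> c)"
    unfolding a(4) by (rule cmp_plus) (use a(1-3) yj E in simp_all)
  moreover have "SuspM T (Plus T (?j \<cdot> \<psi> c) (a \<cdot> \<psi> c)) = Plus T (SuspM T (?j \<cdot> \<psi> c)) (SuspM T (a \<cdot> \<psi> c))"
    by (rule susp_plus) (use a(1-3) yj E in \<open>simp_all add: hom_iff\<close>)
  moreover have "Plus T (SuspM T (?j \<cdot> \<psi> c)) (SuspM T (a \<cdot> \<psi> c)) \<cdot> h =
      Plus T (SuspM T (?j \<cdot> \<psi> c) \<cdot> h) (SuspM T (a \<cdot> \<psi> c) \<cdot> h)"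
    by (rule cmp_plus) (use a(1-3) yj fgh E in simp_all)
  ultimately have "Plus T (SuspM T (?j \<cdot> \<psi> c) \<cdot> h) (SuspM T (a \<cdot> \<psi> c) \<cdot> h) = SuspM T (?j \<cdot> \<psi> c) \<cdot> h"
    using yh by metis
  then have "SuspM T (a \<cdot> \<psi> c) \<cdot> h = Zero T c'' (SuspO T (tgt y))"
    by (rule plus_cancelD) (use a(1-3) yj fgh E in simp_all)
  then obtain b where b: "arr b" "src b = SuspO T c'" "tgt b = SuspO T (tgt y)" "b \<cdot> SuspM T f = SuspM T (a \<cdot> \<psi> c)"
    using extend_susp[OF tri, of "SuspM T (a \<cdot> \<psi> c)"] a(1-3) c E by auto
  obtain b' where b': "arr b'" "src b' = c'" "tgt b' = tgt y" "b = SuspM T b'"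
    using SuspM_full[OF b(1-3)] y E by auto
  have b'f: "b' \<cdot> f = a \<cdot> \<psi> c"
    by (rule SuspM_faithful) (use b(4) b' a(1-3) fgh c E in \<open>simp_all add: SuspM_cmp\<close>)
  obtain t where t: "arr t" "src t = G c'" "tgt t = tgt y" "t \<cdot> \<psi> c' = b'"
    using psi_extend[OF b'(1)] b' y E by auto
  have "(t \<cdot> Gm f) \<cdot> \<psi> c = t \<cdot> (\<psi> c' \<cdot> f)"
    using t(1-3) Gf E by (simp add: assoc)
  also have "\<dots> = a \<cdot> \<psi> c"
    unfolding b'f[symmetric] by (rule reassoc[OF t(4)]) (use t fgh c E in simp_all)
  finally have tG: "t \<cdot> Gm f = a"
    by (rule psi_cancel[OF E(1), rotated -1]) (use t(1-3) a(1-3) Gf(1-3) y(2) in simp_all)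
  have "y \<cdot> x = Plus T (?j \<cdot> x) (a \<cdot> x)"
    unfolding a(4) by (rule cmp_plus) (use a(1-3) yj x(1-3) in simp_all)
  also have "?j \<cdot> x = Zero T (src x) (tgt y)"
    using y1 j x(1-3) jx M' by (simp add: assoc)
  also have "a \<cdot> x = Zero T (src x) (tgt y)"
    unfolding tG[symmetric] using t(1-3) Gf(1-3) x by (simp add: assoc)
  also have "Plus T (Zero T (src x) (tgt y)) (Zero T (src x) (tgt y)) = Zero T (src x) (tgt y)"
    by (rule plus_zero) (use x y in simp_all)
  finally show ?thesis .
qed

text \<open>With \<open>p\<close> a cokernel of \<open>\<delta>\<close>, its kernel \<open>k\<close>
  is the image of \<open>\<delta>\<close>. Since \<open>Gm f\<close> factors through
  \<open>p\<close>, it kills \<open>k\<close>; \<open>factors_of_zero_delta\<close>, with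
  \<open>p\<close> in the role of \<open>y\<close>, gives the converse.\<close>

lemma exact_at_delta_right: "exact_at (full_sub T A) \<delta> (Gm f)"
proof -
  obtain p where p: "is_cokernel (full_sub T A) \<delta> p"
    using full_cokernel_exists[of \<delta>] \<delta> E by auto
  note P = full_cokernelD[OF p]
  have P': "arr p" "src p = G c" "tgt p \<in> A" "p \<cdot> \<delta> = Zero T (F c'') (tgt p)"
    using P(2,5-7) \<delta> by simp_all
  obtain k where k: "is_kernel (full_sub T A) p k"
    using full_kernel_exists[of p] P' E by auto
  note K = full_kernelD[OF k]
  have K': "arr k" "src k \<in> A" "tgt k = G c" "p \<cdot> k = Zero T (src k) (tgt p)"
    using K(2,5-7) P' by simp_all
  have "is_kernel (full_sub T A) (Gm f) k"
  proof (rule full_kernelI)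
    obtain t where t: "arr t" "src t = tgt p" "tgt t = G c'" "t \<cdot> p = Gm f"
      using P(8)[of "Gm f"] \<delta> Gf E Gf_delta by auto
    have "Gm f \<cdot> k = t \<cdot> (p \<cdot> k)"
      by (rule reassoc[OF t(4), symmetric]) (use t K' P' in simp_all)
    then show "Gm f \<cdot> k = Zero T (src k) (tgt (Gm f))"
      using K' t Gf by simp
    show "\<exists>t. arr t \<and> src t = src v \<and> tgt t = src k \<and> k \<cdot> t = v"
      if "arr v" "src v \<in> A" "tgt v = src (Gm f)" "Gm f \<cdot> v = Zero T (src v) (tgt (Gm f))" for v
      using K(8)[of v] factors_of_zero_delta[of p v] that Gf P' by simp
  qed (use K(9) K' Gf E in simp_all)
  moreover have "\<delta> \<in> Hom (full_sub T A) (F c'') (G c)" "Gm f \<in> Hom (full_sub T A) (G c) (G c')"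
    using Gf \<delta> E by (simp_all add: hom_full_sub_iff)
  ultimately show ?thesis
    unfolding exact_at_def is_image_def using p k by blast
qed

end

section \<open>Assembly of the six-term sequence\<close>

lemma six_term_exact_sequence:
  "\<exists>\<delta> \<in> Hom T (F c'') (G c). \<exists>z. is_zero_ob (full_sub T A) z \<and>
     exact_sequence (full_sub T A) [Zero T z (F c), Fm f, Fm g, \<delta>, Gm f, Gm g, Zero T (G c'') z]"
proof -
  obtain \<delta> where \<delta>: "arr \<delta>" "src \<delta> = F c''" "tgt \<delta> = G c"
    "SuspM T \<delta> = SuspM T (\<psi> c) \<cdot> (h \<cdot> \<phi> c'')"
    using connecting_hom_exists[OF fgh(3) _ fgh(6) E(1)] E(3) unfolding fgh(5) by blast
  obtain z where z: "is_zero_ob (full_sub T A) z"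
    using full_zero_ob by blast
  have "exact_at (full_sub T A) (Zero T z (F c)) (Fm f)"
    using full_exact_zero_left[OF z Fm_kernel] Ff by simp
  moreover have "exact_at (full_sub T A) (Gm g) (Zero T (G c'') z)"
    using full_exact_zero_right[OF z Gm_cokernel] Gg by simp
  moreover note full_exact(1)[OF Fm_kernel] full_exact(2)[OF Gm_cokernel]
    exact_at_delta_left[OF \<delta>] exact_at_delta_right[OF \<delta>]
  ultimately have "exact_sequence (full_sub T A)
      [Zero T z (F c), Fm f, Fm g, \<delta>, Gm f, Gm g, Zero T (G c'') z]"
    unfolding exact_sequence_def by (auto simp: less_Suc_eq nth_Cons split: nat.splits)
  moreover have "\<delta> \<in> Hom T (F c'') (G c)"
    using \<delta> by (simp add: hom_iff)
  ultimately show ?thesis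
    using z by blast
qed

end

end

theorem lemmaA:
  fixes T :: "('o, 'm, 'z) tricat_scheme" and A SA E :: "'o set"
  defines "SA \<equiv> SuspO T ` A"
    and "E \<equiv> ext_product T (SuspO T ` A) A"
  assumes "triangulated_category T"
    and "proper_abelian_subcategory T A"
    and "krull_schmidt T"
    and "\<And>i. i \<in> {1, 2} \<Longrightarrow> hom_vanish T A (desusp T i A)"
  shows
    "(\<forall>c \<in> E.
        (\<exists>a\<^sub>1 \<in> A. \<exists>\<phi>. min_right_approx T SA (SuspO T a\<^sub>1) c \<phi>) \<and>
        (\<forall>x \<phi> x' \<phi>'. min_right_approx T SA x c \<phi> \<and> min_right_approx T SA x' c \<phi>' \<longrightarrow>
           (\<exists>\<theta> \<in> Hom T x x'. is_isomorphism T \<theta> \<and> \<phi>' \<cdot>\<^bsub>T\<^esub> \<theta> = \<phi>)) \<and>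
        (\<exists>a\<^sub>0 \<in> A. \<exists>\<psi>. min_left_approx T A c a\<^sub>0 \<psi>) \<and>
        (\<forall>x \<psi> x' \<psi>'. min_left_approx T A c x \<psi> \<and> min_left_approx T A c x' \<psi>' \<longrightarrow>
           (\<exists>\<theta> \<in> Hom T x x'. is_isomorphism T \<theta> \<and> \<theta> \<cdot>\<^bsub>T\<^esub> \<psi> = \<psi>'))) \<and>
     (\<forall>F G \<phi> \<psi>.
        (\<forall>c \<in> E. F c \<in> A \<and> min_right_approx T SA (SuspO T (F c)) c (\<phi> c)) \<and>
        (\<forall>c \<in> E. G c \<in> A \<and> min_left_approx T A c (G c) (\<psi> c)) \<longrightarrow>
        (\<forall>c \<in> E. \<forall>c' \<in> E. \<forall>f \<in> Hom T c c'.
           (\<exists>!h. F_rel T F \<phi> c c' f h) \<and> (\<exists>!h. G_rel T G \<psi> c c' f h)) \<and>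
        is_functor (full_sub T E) (full_sub T A) F (F_mor T F \<phi>) \<and>
        is_functor (full_sub T E) (full_sub T A) G (G_mor T G \<psi>) \<and>
        (\<forall>c \<in> E. \<forall>c' \<in> E. \<forall>c'' \<in> E. \<forall>f \<in> Hom T c c'. \<forall>g \<in> Hom T c' c''. \<forall>h.
           (f, g, h) \<in> Tri T \<longrightarrow>
           (\<exists>\<delta> \<in> Hom T (F c'') (G c). \<exists>z. is_zero_ob (full_sub T A) z \<and>
              exact_sequence (full_sub T A)
                [Zero T z (F c), F_mor T F \<phi> f, F_mor T F \<phi> g, \<delta>,
                 G_mor T G \<psi> f, G_mor T G \<psi> g, Zero T (G c'') z])))"
proof -
  interpret proper_abelian_setting T A
    using assms(3,4,6) by (simp add: proper_abelian_setting_def proper_abelian_setting_axioms_def)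
  show ?thesis
    unfolding SA_def E_def
  proof (intro conjI ballI allI impI; (elim conjE)?)
    fix c assume "c \<in> ext_product T (SuspO T ` A) A"
    then obtain a \<phi> \<psi> \<chi> where ext: "extension_tri a \<phi> \<psi> \<chi>" and c: "tgt \<phi> = c"
      by (rule E_extension_tri)
    show "\<exists>a\<^sub>1\<in>A. \<exists>\<phi>. min_right_approx T (SuspO T ` A) (SuspO T a\<^sub>1) c \<phi>"
      using ext_min_right_approx[OF ext] ext_tri(2)[OF ext] unfolding c by blast
    show "\<exists>a\<^sub>0\<in>A. \<exists>\<psi>. min_left_approx T A c a\<^sub>0 \<psi>"
      using ext_min_left_approx[OF ext] ext_tri(4)[OF ext] unfolding c by blast
  next
    fix c x \<phi> x' \<phi>'
    assume "min_right_approx T (SuspO T ` A) x c \<phi>" "min_right_approx T (SuspO T ` A) x' c \<phi>'"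
    then show "\<exists>\<theta>\<in>Hom T x x'. is_isomorphism T \<theta> \<and> \<phi>' \<cdot>\<^bsub>T\<^esub> \<theta> = \<phi>"
      by (rule min_right_approx_unique)
  next
    fix c x \<psi> x' \<psi>'
    assume "min_left_approx T A c x \<psi>" "min_left_approx T A c x' \<psi>'"
    then show "\<exists>\<theta>\<in>Hom T x x'. is_isomorphism T \<theta> \<and> \<theta> \<cdot>\<^bsub>T\<^esub> \<psi> = \<psi>'"
      by (rule min_left_approx_unique)
  next
    fix F G \<phi> \<psi>
    assume FG:
      "\<forall>c\<in>ext_product T (SuspO T ` A) A. F c \<in> A \<and> min_right_approx T (SuspO T ` A) (SuspO T (F c)) c (\<phi> c)"
      "\<forall>c\<in>ext_product T (SuspO T ` A) A. G c \<in> A \<and> min_left_approx T A c (G c) (\<psi> c)"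
    interpret approx_functors T A F G \<phi> \<psi>
      by unfold_locales (use FG in blast)+
    show "is_functor (full_sub T (ext_product T (SuspO T ` A) A)) (full_sub T A) F (F_mor T F \<phi>)"
      by (rule F_functor)
    show "is_functor (full_sub T (ext_product T (SuspO T ` A) A)) (full_sub T A) G (G_mor T G \<psi>)"
      by (rule G_functor)
    fix c c' f
    assume c: "c \<in> ext_product T (SuspO T ` A) A" "c' \<in> ext_product T (SuspO T ` A) A"
      and f: "f \<in> Hom T c c'"
    show "\<exists>!h. F_rel T F \<phi> c c' f h"
      by (rule F_rel_ex1[OF c f])
    show "\<exists>!h. G_rel T G \<psi> c c' f h"
      by (rule G_rel_ex1[OF c f])
    fix c'' g h
    assume c'': "c'' \<in> ext_product T (SuspO T ` A) A" and g: "g \<in> Hom T c' c''" and fgh: "(f, g, h) \<in> Tri T"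
    show "\<exists>\<delta>\<in>Hom T (F c'') (G c). \<exists>z. is_zero_ob (full_sub T A) z \<and>
        exact_sequence (full_sub T A)
          [Zero T z (F c), F_mor T F \<phi> f, F_mor T F \<phi> g, \<delta>, G_mor T G \<psi> f, G_mor T G \<psi> g, Zero T (G c'') z]"
      by (rule six_term_exact_sequence[OF fgh _ _ _ c c'']) (use f g in \<open>simp_all add: hom_iff\<close>)
  qed
qed

end
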